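(* For all non-constant dominants $f,g$ of the universal cover $\mathcal A$ of $U(n)$, the relative growth satisfies $\gamma(f,g)=\mu(g)/\mu(f)$.
   Context: $\mathcal A$: homotopy classes rel endpoints of paths $u:[0,1]\to U(n)$, $u(0)=I$, with $\dot uu^{-1}=ih_u(t)$, $h_u$ Hermitian. Order: $f\ge g$ iff $fg^{-1}$ has a representative with $h(t)$ positive semidefinite for all $t$. Dominants: elements with a representative having $h_u(t)$ positive definite for all $t$. $\gamma_n(f,g)=\inf\{p\in\mathbb Z:f^p\ge g^n\}$, $\gamma(f,g)=\lim_{n\to\infty}\gamma_n(f,g)/n$. $\mu(u)=\theta(1)-\theta(0)$ with $\theta$ continuous, $\det u(t)=e^{i\theta(t)}$ (positive on dominants). *)

theory Defs
  imports "HOL-Analysis.Analysis"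
begin

definition cadj :: "complex^'n^'n \<Rightarrow> complex^'n^'n" where
  "cadj A = (\<chi> i j. cnj (A $ j $ i))"

definition unitary_group :: "(complex^'n^'n) set" where
  "unitary_group = {U. U ** cadj U = mat 1}"

definition hermitian :: "complex^'n^'n \<Rightarrow> bool" where
  "hermitian H \<longleftrightarrow> cadj H = H"

definition qform :: "complex^'n^'n \<Rightarrow> complex^'n \<Rightarrow> complex" where
  "qform H x = (\<Sum>i\<in>UNIV. \<Sum>j\<in>UNIV. cnj (x $ i) * H $ i $ j * x $ j)"

definition pos_semidef :: "complex^'n^'n \<Rightarrow> bool" where
  "pos_semidef H \<longleftrightarrow> hermitian H \<and> (\<forall>x. 0 \<le> Re (qform H x))"

definition pos_def :: "complex^'n^'n \<Rightarrow> bool" where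
  "pos_def H \<longleftrightarrow> hermitian H \<and> (\<forall>x. x \<noteq> 0 \<longrightarrow> 0 < Re (qform H x))"

definition upath :: "(real \<Rightarrow> complex^'n^'n) \<Rightarrow> bool" where
  "upath u \<longleftrightarrow> path u \<and> path_image u \<subseteq> unitary_group \<and> u 0 = mat 1"

definition cls :: "(real \<Rightarrow> complex^'n^'n) \<Rightarrow> (real \<Rightarrow> complex^'n^'n) set" where
  "cls u = {v. homotopic_paths unitary_group u v}"

definition UC :: "(real \<Rightarrow> complex^'n^'n) set set" where
  "UC = {cls u | u. upath u}"

definition rep :: "(real \<Rightarrow> complex^'n^'n) set \<Rightarrow> (real \<Rightarrow> complex^'n^'n)" where
  "rep f = (SOME u. u \<in> f)"

definition amul :: "(real \<Rightarrow> complex^'n^'n) set \<Rightarrow> (real \<Rightarrow> complex^'n^'n) set \<Rightarrow> (real \<Rightarrow> complex^'n^'n) set" where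
  "amul f g = cls (\<lambda>t. rep f t ** rep g t)"

definition ainv :: "(real \<Rightarrow> complex^'n^'n) set \<Rightarrow> (real \<Rightarrow> complex^'n^'n) set" where
  "ainv f = cls (\<lambda>t. cadj (rep f t))"

definition aone :: "(real \<Rightarrow> complex^'n^'n) set" where
  "aone = cls (\<lambda>t. mat 1)"

definition apow :: "(real \<Rightarrow> complex^'n^'n) set \<Rightarrow> int \<Rightarrow> (real \<Rightarrow> complex^'n^'n) set" where
  "apow f k = (if 0 \<le> k then (amul f ^^ nat k) aone else (amul (ainv f) ^^ nat (- k)) aone)"

definition hamiltonian_path ::
  "(real \<Rightarrow> complex^'n^'n) \<Rightarrow> (real \<Rightarrow> complex^'n^'n) \<Rightarrow> bool" where
  "hamiltonian_path u h \<longleftrightarrow> (\<exists>u'. continuous_on {0..1} u' \<and>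
      (\<forall>t\<in>{0..1}. (u has_vector_derivative u' t) (at t within {0..1}) \<and>
                   u' t ** cadj (u t) = (\<chi> i j. \<i> * h t $ i $ j) \<and> hermitian (h t)))"

definition ageq :: "(real \<Rightarrow> complex^'n^'n) set \<Rightarrow> (real \<Rightarrow> complex^'n^'n) set \<Rightarrow> bool" where
  "ageq f g \<longleftrightarrow> (\<exists>u\<in>amul f (ainv g). \<exists>h. hamiltonian_path u h \<and> (\<forall>t\<in>{0..1}. pos_semidef (h t)))"

definition dominant :: "(real \<Rightarrow> complex^'n^'n) set \<Rightarrow> bool" where
  "dominant f \<longleftrightarrow> f \<in> UC \<and> (\<exists>u\<in>f. \<exists>h. hamiltonian_path u h \<and> (\<forall>t\<in>{0..1}. pos_def (h t)))"

definition gamma_n :: "(real \<Rightarrow> complex^'n^'n) set \<Rightarrow> (real \<Rightarrow> complex^'n^'n) set \<Rightarrow> nat \<Rightarrow> real" where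
  "gamma_n f g n = Inf (real_of_int ` {p::int. ageq (apow f p) (apow g (int n))})"

definition mu :: "(real \<Rightarrow> complex^'n^'n) set \<Rightarrow> real" where
  "mu f = (THE m. \<exists>u\<in>f. \<exists>\<theta>. continuous_on {0..1} \<theta> \<and>
              (\<forall>t\<in>{0..1}. det (u t) = cis (\<theta> t)) \<and> m = \<theta> 1 - \<theta> 0)"

end

theory Submission
  imports Defs
begin

text \<open>
  If \<open>f\<^sup>p \<ge> g\<^sup>n\<close> then \<open>f\<^sup>p g\<^sup>-\<^sup>n\<close> has a representative with positive semidefinite \<open>h\<close>,
  whose determinant angle grows with speed \<open>tr h \<ge> 0\<close>; hence \<open>p \<mu>(f) \<ge> n \<mu>(g)\<close>.
  Conversely there is a constant \<open>C\<close> such that every class with \<open>\<mu> \<ge> C\<close> is \<open>\<ge> 1\<close>, so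
  \<open>\<gamma>\<^sub>n(f,g)\<close> differs from \<open>n \<mu>(g)/\<mu>(f)\<close> by a bounded amount.

  To find \<open>C\<close>, consider a path \<open>u\<close> in the subgroup fixing some of the coordinate vectors and let
  \<open>c = u e\<^sub>i\<close> for one that need not be fixed. After a perturbation, \<open>c\<close> misses a point \<open>q\<close> of the
  unit sphere, so the complex reflections \<open>W(t)\<close> mapping \<open>q\<close> to \<open>c(t)\<close> depend continuously on \<open>t\<close>,
  and \<open>u = W(t) W(0)\<^sup>* u\<^sub>1\<close> where \<open>u\<^sub>1\<close> also fixes \<open>e\<^sub>i\<close>. The angle of \<open>W(t)\<close> is continuous in
  \<open>(0, 2\<pi>)\<close>, so \<open>W(t) W(0)\<^sup>*\<close> is homotopic to a product of two nonnegative one-parameter groups of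
  reflections and a full negative turn. All full turns are homotopic, so the latter can be taken about
  some other \<open>e\<^sub>k\<close> and absorbed in \<open>u\<^sub>1\<close>. Thus each step costs at most \<open>4\<pi>\<close> of winding, and when
  a single coordinate is left the path is determined up to homotopy by its angle.
\<close>

section \<open>Unitary matrices and complex reflections\<close>

text \<open>Antilinear in the first argument, the convention that matches
  \<open>qform\<close>.\<close>

definition cin :: "complex^'n \<Rightarrow> complex^'n \<Rightarrow> complex" where
  "cin x y = (\<Sum>i\<in>UNIV. cnj (x $ i) * y $ i)"

lemma cin_add_right: "cin z (x + y) = cin z x + cin z y"
  and cin_diff_left: "cin (x - y) z = cin x z - cin y z"
  and cin_diff_right: "cin z (x - y) = cin z x - cin z y"
  and cin_minus_left: "cin (- x) z = - cin x z"
  and cin_minus_right: "cin z (- x) = - cin z x"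
  and cin_smult_right: "cin x (c *s y) = c * cin x y"
  and cin_smult_left: "cin (c *s x) y = cnj c * cin x y"
  and cin_scaleR_left: "cin (r *\<^sub>R x) y = of_real r * cin x y"
  by (simp_all add: cin_def algebra_simps sum.distrib sum_subtractf sum_negf sum_distrib_left
      scaleR_conv_of_real [where 'a = complex])

lemma cin_commute: "cin y x = cnj (cin x y)"
  by (simp add: cin_def mult.commute)

lemma cin_self: "cin x x = of_real ((norm x)\<^sup>2)"
proof -
  have "(norm x)\<^sup>2 = (\<Sum>i\<in>UNIV. (cmod (x $ i))\<^sup>2)"
    by (simp add: norm_vec_def L2_set_def sum_nonneg)
  then show ?thesis
    by (simp add: cin_def complex_norm_square mult.commute del: of_real_power)
qed

lemma cin_unit: "norm x = 1 \<Longrightarrow> cin x x = 1"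
  by (simp add: cin_self)

lemma cin_matrix_left: "cin (A *v x) y = cin x (cadj A *v y)"
  unfolding cin_def matrix_vector_mult_def cadj_def
  by (simp add: sum_distrib_left sum_distrib_right)
     (subst sum.swap, simp add: algebra_simps)

lemma cadj_cadj [simp]: "cadj (cadj A) = A"
  by (simp add: cadj_def vec_eq_iff)

lemma cadj_mat1 [simp]: "cadj (mat 1) = mat 1"
  by (simp add: cadj_def vec_eq_iff mat_def)

lemma cadj_mult: "cadj (A ** B) = cadj B ** cadj A"
  by (simp add: cadj_def vec_eq_iff matrix_matrix_mult_def mult.commute)

lemma qform_cin: "qform H x = cin x (H *v x)"
  by (simp add: qform_def cin_def matrix_vector_mult_def sum_distrib_left algebra_simps)

lemma unitary_right: "U \<in> unitary_group \<Longrightarrow> U ** cadj U = mat 1"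
  by (simp add: unitary_group_def)

lemma unitary_left: "U \<in> unitary_group \<Longrightarrow> cadj U ** U = mat 1"
  by (simp add: unitary_group_def matrix_left_right_inverse)

lemma unitary_mat1 [simp]: "mat 1 \<in> unitary_group"
  by (simp add: unitary_group_def)

lemma unitary_cadj: "U \<in> unitary_group \<Longrightarrow> cadj U \<in> unitary_group"
  by (simp add: unitary_group_def matrix_left_right_inverse)

lemma unitary_mult:
  assumes "U \<in> unitary_group" "V \<in> unitary_group"
  shows "U ** V \<in> unitary_group"
proof -
  have "(U ** V) ** cadj (U ** V) = U ** (V ** cadj V) ** cadj U"
    by (simp add: cadj_mult matrix_mul_assoc)
  then show ?thesis using assms by (simp add: unitary_group_def)
qed

lemma unitary_cancel_left [simp]:
  assumes "U \<in> unitary_group"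
  shows "cadj U ** (U ** A) = A" "U ** (cadj U ** A) = A"
  using assms by (simp_all add: matrix_mul_assoc unitary_left unitary_right)

lemma unitary_cadj_vec:
  assumes "U \<in> unitary_group" "U *v x = y"
  shows "cadj U *v y = x"
  using assms by (auto simp: matrix_vector_mul_assoc unitary_left)

lemma unitary_cin:
  assumes "U \<in> unitary_group" shows "cin (U *v x) (U *v y) = cin x y"
  by (simp add: cin_matrix_left matrix_vector_mul_assoc unitary_left assms)

lemma unitary_norm:
  assumes "U \<in> unitary_group" shows "norm (U *v x) = norm x"
proof -
  have "of_real ((norm (U *v x))\<^sup>2) = (of_real ((norm x)\<^sup>2) :: complex)"
    by (metis assms cin_self unitary_cin)
  then have "(norm (U *v x))\<^sup>2 = (norm x)\<^sup>2"
    using of_real_eq_iff by blast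
  then show ?thesis by simp
qed

section \<open>Continuity of matrix operations and determinants of unitary matrices\<close>

lemma continuous_on_matrix_mult [continuous_intros]:
  fixes f :: "'a::topological_space \<Rightarrow> complex^'n^'m" and g :: "'a \<Rightarrow> complex^'k^'n"
  assumes "continuous_on S f" "continuous_on S g"
  shows "continuous_on S (\<lambda>x. f x ** g x)"
  unfolding matrix_matrix_mult_def by (intro continuous_intros assms)

lemma continuous_on_matrix_vector_mult [continuous_intros]:
  fixes f :: "'a::topological_space \<Rightarrow> complex^'n^'m"
  assumes "continuous_on S f" "continuous_on S g"
  shows "continuous_on S (\<lambda>x. f x *v g x)"
  unfolding matrix_vector_mult_def by (intro continuous_intros assms)

lemma continuous_on_cadj [continuous_intros]:
  assumes "continuous_on S f" shows "continuous_on S (\<lambda>x. cadj (f x))"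
  unfolding cadj_def by (intro continuous_intros assms)

lemma continuous_on_cin [continuous_intros]:
  assumes "continuous_on S f" "continuous_on S g"
  shows "continuous_on S (\<lambda>x. cin (f x) (g x))"
  unfolding cin_def by (intro continuous_intros assms)

lemma continuous_on_det [continuous_intros]:
  fixes f :: "'a::topological_space \<Rightarrow> complex^'n^'n"
  assumes "continuous_on S f" shows "continuous_on S (\<lambda>x. det (f x))"
  unfolding det_def by (intro continuous_intros assms)

lemma det_cadj: "det (cadj U) = cnj (det U)"
proof -
  have "det (cadj U) = det (\<chi> i j. cnj (U $ i $ j))"
    by (subst det_transpose [symmetric]) (simp add: cadj_def transpose_def)
  also have "\<dots> = cnj (det U)"
    by (simp add: det_def)
  finally show ?thesis .
qed

lemma unitary_det: "U \<in> unitary_group \<Longrightarrow> cmod (det U) = 1"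
proof -
  assume U: "U \<in> unitary_group"
  have "det U * cnj (det U) = 1"
    by (metis U det_I det_cadj det_mul unitary_right)
  then have "(cmod (det U))\<^sup>2 = 1"
    by (metis complex_norm_square of_real_eq_1_iff)
  then show ?thesis by (simp add: power2_eq_1_iff) (smt (verit) norm_ge_zero)
qed

text \<open>\<open>I + (z - 1) v v\<^sup>*\<close>, which has eigenvalue \<open>z\<close> on \<open>v\<close> only if \<open>v\<close> is a unit vector.\<close>
definition reflection :: "complex^'n \<Rightarrow> complex \<Rightarrow> complex^'n^'n" where
  "reflection v z = (\<chi> i j. (if i = j then 1 else 0) + (z - 1) * v $ i * cnj (v $ j))"

lemma reflection_vec: "reflection v z *v x = x + ((z - 1) * cin v x) *s v"
proof -
  have *: "(\<Sum>j\<in>UNIV. ((if i = j then 1 else 0) + (z - 1) * v $ i * cnj (v $ j)) * x $ j)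
     = x $ i + (z - 1) * (\<Sum>j\<in>UNIV. cnj (v $ j) * x $ j) * v $ i" for i
    by (simp add: algebra_simps sum.distrib sum_subtractf sum_distrib_left if_distrib [of "\<lambda>c. _ * c"]
        cong: if_cong)
  show ?thesis
    unfolding vec_eq_iff reflection_def matrix_vector_mult_def cin_def using * by simp
qed

lemma reflection_one [simp]: "reflection v 1 = mat 1"
  by (simp add: reflection_def mat_def)

lemma cadj_refl: "cadj (reflection v z) = reflection v (cnj z)"
  by (simp add: reflection_def cadj_def vec_eq_iff mult.commute mult.left_commute)

lemma reflection_mult:
  assumes "norm v = 1" shows "reflection v z ** reflection v w = reflection v (z * w)"
proof -
  have "(reflection v z ** reflection v w) *v x = reflection v (z * w) *v x" for x
    by (simp add: matrix_vector_mul_assoc [symmetric] reflection_vec cin_add_right cin_smult_right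
        cin_unit assms) (simp add: vec_eq_iff algebra_simps)
  then show ?thesis by (simp add: matrix_eq)
qed

lemma reflection_unitary:
  assumes "norm v = 1" "cmod z = 1" shows "reflection v z \<in> unitary_group"
  using assms complex_norm_square[of z]
  by (simp add: unitary_group_def cadj_refl reflection_mult)

lemma continuous_on_refl [continuous_intros]:
  assumes "continuous_on S f" "continuous_on S g"
  shows "continuous_on S (\<lambda>x. reflection (f x) (g x))"
  unfolding reflection_def by (intro continuous_intros assms)

lemma reflection_fix: "cin v x = 0 \<Longrightarrow> reflection v z *v x = x"
  by (simp add: reflection_vec)

text \<open>The eigenvalue is the one for which the unit vector \<open>a\<close> is mapped to the unit vector \<open>b \<noteq> a\<close>.\<close>
definition reflection_to :: "complex^'n \<Rightarrow> complex^'n \<Rightarrow> complex^'n^'n" where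
  "reflection_to a b = reflection (sgn (a - b)) (- cnj (1 - cin b a) / (1 - cin b a))"

text \<open>Expanding the squared length of \<open>a - b\<close> gives the second claim, and its
  positivity the first. The positive real part keeps the denominator in \<open>reflection_to\<close>
  nonzero and later lets the angle be taken from the principal logarithm.\<close>

lemma reflection_to_denom:
  assumes "norm a = 1" "norm b = 1" "a \<noteq> b"
  shows "Re (1 - cin b a) > 0"
    and "(1 - cin b a) + cnj (1 - cin b a) = of_real ((norm (a - b))\<^sup>2)"
proof -
  show *: "(1 - cin b a) + cnj (1 - cin b a) = of_real ((norm (a - b))\<^sup>2)"
    unfolding cin_self [symmetric]
    by (simp add: cin_diff_left cin_diff_right cin_unit assms cin_commute [of a b])
  have "2 * Re (1 - cin b a) = (norm (a - b))\<^sup>2"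
    using arg_cong [OF *, of Re] by simp
  moreover have "(norm (a - b))\<^sup>2 > 0" using assms by simp
  ultimately show "Re (1 - cin b a) > 0" by linarith
qed

lemma cmod_minus_cnj_divide: "d \<noteq> 0 \<Longrightarrow> cmod (- cnj d / d) = 1"
  by (simp add: norm_divide)

lemma reflection_to_unitary:
  assumes "norm a = 1" "norm b = 1" "a \<noteq> b"
  shows "reflection_to a b \<in> unitary_group"
  unfolding reflection_to_def
  using assms reflection_to_denom [OF assms] by (intro reflection_unitary cmod_minus_cnj_divide)
    (auto simp: norm_sgn)

text \<open>With \<open>d = 1 - cin b a\<close>, which is also \<open>cin (a - b) a\<close>, the
  eigenvalue minus one is minus the squared length of \<open>a - b\<close> divided by
  \<open>d\<close>. The factor \<open>d\<close> cancels, and the correction to \<open>a\<close> is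
  \<open>b - a\<close>.\<close>

lemma reflection_to_vec:
  assumes "norm a = 1" "norm b = 1" "a \<noteq> b"
  shows "reflection_to a b *v a = b"
proof -
  define d where "d = 1 - cin b a"
  have d0: "d \<noteq> 0" using reflection_to_denom(1) [OF assms] by (auto simp: d_def)
  have dd: "d + cnj d = of_real ((norm (a - b))\<^sup>2)"
    using reflection_to_denom(2) [OF assms] by (simp add: d_def)
  have n0: "norm (a - b) \<noteq> 0" using assms by simp
  have c: "cin (a - b) a = d" by (simp add: cin_diff_left cin_unit assms d_def)
  have z: "- cnj d / d - 1 = - of_real ((norm (a - b))\<^sup>2) / d"
    unfolding dd [symmetric] using d0 by (simp add: field_simps)
  have "reflection_to a b *v a = a + ((- cnj d / d - 1) * cin (sgn (a - b)) a) *s sgn (a - b)"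
    by (simp add: reflection_to_def reflection_vec d_def)
  also have "((- cnj d / d - 1) * cin (sgn (a - b)) a) *s sgn (a - b) = - (a - b)"
    unfolding z sgn_div_norm cin_scaleR_left c using d0 n0
    by (simp add: vec_eq_iff scaleR_conv_of_real [where 'a = complex] power2_eq_square field_simps)
  finally show ?thesis by simp
qed

lemma reflection_to_fix:
  assumes "cin a x = 0" "cin b x = 0" shows "reflection_to a b *v x = x"
  unfolding reflection_to_def
  by (rule reflection_fix) (simp add: sgn_div_norm cin_scaleR_left cin_diff_left assms)

lemma continuous_on_refl_to:
  assumes "continuous_on S f" "continuous_on S g"
    and "\<And>x. x \<in> S \<Longrightarrow> norm (f x) = 1 \<and> norm (g x) = 1 \<and> f x \<noteq> g x"
  shows "continuous_on S (\<lambda>x. reflection_to (f x) (g x))"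
  unfolding reflection_to_def
proof (intro continuous_intros assms(1,2) continuous_on_sgn ballI)
  fix x assume "x \<in> S"
  from reflection_to_denom(1) [of "f x" "g x"] assms(3) [OF this]
  show "1 - cin (g x) (f x) \<noteq> 0" by auto
qed (use assms(3) in auto)

section \<open>The determinant angle and the group of homotopy classes\<close>

lemma homotopic_pathsI:
  fixes H :: "real \<Rightarrow> real \<Rightarrow> 'a::topological_space"
  assumes "continuous_on ({0..1} \<times> {0..1}) (\<lambda>x. H (fst x) (snd x))"
    and "\<And>s t. s \<in> {0..1} \<Longrightarrow> t \<in> {0..1} \<Longrightarrow> H s t \<in> S"
    and "\<And>t. t \<in> {0..1} \<Longrightarrow> H 0 t = p t" "\<And>t. t \<in> {0..1} \<Longrightarrow> H 1 t = q t"
    and "\<And>s. s \<in> {0..1} \<Longrightarrow> H s 0 = p 0" "\<And>s. s \<in> {0..1} \<Longrightarrow> H s 1 = p 1"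
  shows "homotopic_paths S p q"
  unfolding homotopic_paths
  by (rule exI [of _ "\<lambda>x. H (fst x) (snd x)"])
     (use assms in \<open>auto simp: pathstart_def pathfinish_def\<close>)

lemma homotopic_pathsE:
  assumes "homotopic_paths S p q"
  obtains H :: "real \<Rightarrow> real \<Rightarrow> 'a::topological_space" where "continuous_on ({0..1} \<times> {0..1}) (\<lambda>x. H (fst x) (snd x))"
    "\<And>s t. s \<in> {0..1} \<Longrightarrow> t \<in> {0..1} \<Longrightarrow> H s t \<in> S"
    "\<And>t. t \<in> {0..1} \<Longrightarrow> H 0 t = p t" "\<And>t. t \<in> {0..1} \<Longrightarrow> H 1 t = q t"
    "\<And>s. s \<in> {0..1} \<Longrightarrow> H s 0 = p 0" "\<And>s. s \<in> {0..1} \<Longrightarrow> H s 1 = p 1"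
proof -
  obtain h where h: "continuous_on ({0..1} \<times> {0..1}) h" "h \<in> {0..1} \<times> {0..1} \<rightarrow> S"
     "\<forall>x\<in>{0..1}. h (0, x) = p x" "\<forall>x\<in>{0..1}. h (1, x) = q x"
     "\<forall>t\<in>{0..1::real}. pathstart (h \<circ> Pair t) = pathstart p \<and> pathfinish (h \<circ> Pair t) = pathfinish p"
    using assms unfolding homotopic_paths by blast
  show thesis
    by (rule that [of "\<lambda>s t. h (s, t)"])
       (use h in \<open>auto simp: pathstart_def pathfinish_def\<close>)
qed

lemma upath_iff:
  "upath u \<longleftrightarrow> continuous_on {0..1} u \<and> (\<forall>t\<in>{0..1}. u t \<in> unitary_group) \<and> u 0 = mat 1"
  by (auto simp: upath_def path_def path_image_def)

lemma upathI:
  assumes "continuous_on {0..1} u" "\<And>t. t \<in> {0..1} \<Longrightarrow> u t \<in> unitary_group" "u 0 = mat 1"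
  shows "upath u"
  using assms by (simp add: upath_iff)

lemma upathD:
  assumes "upath u"
  shows "continuous_on {0..1} u" "\<And>t. t \<in> {0..1} \<Longrightarrow> u t \<in> unitary_group" "u 0 = mat 1"
  using assms by (auto simp: upath_iff)

lemma upath_homotopic:
  assumes "upath u" "homotopic_paths unitary_group u v" shows "upath v"
  using assms homotopic_paths_imp_path [OF assms(2)] homotopic_paths_imp_subset [OF assms(2)]
    homotopic_paths_imp_pathstart [OF assms(2)]
  by (simp add: upath_def pathstart_def)

lemma upath_homotopic_refl: "upath u \<Longrightarrow> homotopic_paths unitary_group u u"
  by (simp add: upath_def)

lemma upath_mult: "upath u \<Longrightarrow> upath v \<Longrightarrow> upath (\<lambda>t. u t ** v t)"
  by (simp add: upath_iff continuous_on_matrix_mult unitary_mult)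

lemma upath_cadj: "upath u \<Longrightarrow> upath (\<lambda>t. cadj (u t))"
  by (simp add: upath_iff continuous_on_cadj unitary_cadj)

lemma homotopic_mult:
  assumes "homotopic_paths unitary_group u u'" "homotopic_paths unitary_group v v'"
  shows "homotopic_paths unitary_group (\<lambda>t. u t ** v t) (\<lambda>t. u' t ** v' t)"
proof -
  obtain H :: "real \<Rightarrow> real \<Rightarrow> _" where H: "continuous_on ({0..1} \<times> {0..1}) (\<lambda>x. H (fst x) (snd x))"
    "\<And>s t. s \<in> {0..1} \<Longrightarrow> t \<in> {0..1} \<Longrightarrow> H s t \<in> unitary_group"
    "\<And>t. t \<in> {0..1} \<Longrightarrow> H 0 t = u t" "\<And>t. t \<in> {0..1} \<Longrightarrow> H 1 t = u' t"
    "\<And>s. s \<in> {0..1} \<Longrightarrow> H s 0 = u 0" "\<And>s. s \<in> {0..1} \<Longrightarrow> H s 1 = u 1"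
    using homotopic_pathsE [OF assms(1)] by blast
  obtain K :: "real \<Rightarrow> real \<Rightarrow> _" where K: "continuous_on ({0..1} \<times> {0..1}) (\<lambda>x. K (fst x) (snd x))"
    "\<And>s t. s \<in> {0..1} \<Longrightarrow> t \<in> {0..1} \<Longrightarrow> K s t \<in> unitary_group"
    "\<And>t. t \<in> {0..1} \<Longrightarrow> K 0 t = v t" "\<And>t. t \<in> {0..1} \<Longrightarrow> K 1 t = v' t"
    "\<And>s. s \<in> {0..1} \<Longrightarrow> K s 0 = v 0" "\<And>s. s \<in> {0..1} \<Longrightarrow> K s 1 = v 1"
    using homotopic_pathsE [OF assms(2)] by blast
  show ?thesis
    by (rule homotopic_pathsI [where H = "\<lambda>s t. H s t ** K s t"])
       (use H K in \<open>auto intro: continuous_on_matrix_mult unitary_mult\<close>)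
qed

lemma homotopic_cadj:
  assumes "homotopic_paths unitary_group u u'"
  shows "homotopic_paths unitary_group (\<lambda>t. cadj (u t)) (\<lambda>t. cadj (u' t))"
proof -
  obtain H :: "real \<Rightarrow> real \<Rightarrow> _" where H: "continuous_on ({0..1} \<times> {0..1}) (\<lambda>x. H (fst x) (snd x))"
    "\<And>s t. s \<in> {0..1} \<Longrightarrow> t \<in> {0..1} \<Longrightarrow> H s t \<in> unitary_group"
    "\<And>t. t \<in> {0..1} \<Longrightarrow> H 0 t = u t" "\<And>t. t \<in> {0..1} \<Longrightarrow> H 1 t = u' t"
    "\<And>s. s \<in> {0..1} \<Longrightarrow> H s 0 = u 0" "\<And>s. s \<in> {0..1} \<Longrightarrow> H s 1 = u 1"
    using homotopic_pathsE [OF assms(1)] by blast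
  show ?thesis
    by (rule homotopic_pathsI [where H = "\<lambda>s t. cadj (H s t)"])
       (use H in \<open>auto intro: continuous_on_cadj unitary_cadj\<close>)
qed

section \<open>Lifting the determinant to an angle\<close>

text \<open>At each point the two lifts differ by a multiple of 2 pi, and a continuous function with
  such discrete values is constant on a connected set.\<close>

lemma cis_lift_unique:
  fixes \<theta> \<phi> :: "'a::topological_space \<Rightarrow> real"
  assumes "connected S" "continuous_on S \<theta>" "continuous_on S \<phi>"
    and eq: "\<And>x. x \<in> S \<Longrightarrow> cis (\<theta> x) = cis (\<phi> x)"
    and ab: "a \<in> S" "b \<in> S"
  shows "\<theta> b - \<theta> a = \<phi> b - \<phi> a"
proof -
  have Z: "\<exists>n::int. \<theta> x - \<phi> x = 2 * pi * n" if "x \<in> S" for x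
    using eq [OF that] sin_cos_eq_iff [of "\<theta> x" "\<phi> x"]
    by (force simp: complex_eq_iff)
  have "(\<lambda>x. \<theta> x - \<phi> x) constant_on S"
  proof (rule continuous_discrete_range_constant [OF assms(1)])
    show "continuous_on S (\<lambda>x. \<theta> x - \<phi> x)" by (intro continuous_intros assms)
    fix x assume x: "x \<in> S"
    show "\<exists>e>0. \<forall>y. y \<in> S \<and> \<theta> y - \<phi> y \<noteq> \<theta> x - \<phi> x \<longrightarrow> e \<le> norm (\<theta> y - \<phi> y - (\<theta> x - \<phi> x))"
    proof (intro exI [of _ "2 * pi"] conjI allI impI)
      fix y assume y: "y \<in> S \<and> \<theta> y - \<phi> y \<noteq> \<theta> x - \<phi> x"
      obtain m n :: int where mn: "\<theta> x - \<phi> x = 2 * pi * m" "\<theta> y - \<phi> y = 2 * pi * n"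
        using Z x y by metis
      have "n \<noteq> m" using y mn by auto
      then have "1 \<le> \<bar>real_of_int (n - m)\<bar>" by linarith
      then have "2 * pi * 1 \<le> 2 * pi * \<bar>real_of_int (n - m)\<bar>"
        by (intro mult_left_mono) auto
      also have "\<dots> = norm (\<theta> y - \<phi> y - (\<theta> x - \<phi> x))"
        unfolding mn by (simp add: abs_mult right_diff_distrib [symmetric])
      finally show "2 * pi \<le> norm (\<theta> y - \<phi> y - (\<theta> x - \<phi> x))" by simp
    qed auto
  qed
  then obtain c where "\<And>x. x \<in> S \<Longrightarrow> \<theta> x - \<phi> x = c"
    by (auto simp: constant_on_def)
  from this [OF ab(1)] this [OF ab(2)] show ?thesis by linarith
qed

text \<open>The relation inside the \<open>THE\<close> of \<open>mu\<close>, stated for a single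
  path; existence and uniqueness of the value are then separate facts.\<close>

definition winding :: "(real \<Rightarrow> complex^'n^'n) \<Rightarrow> real \<Rightarrow> bool" where
  "winding u m \<longleftrightarrow> (\<exists>\<theta>. continuous_on {0..1} \<theta> \<and>
     (\<forall>t\<in>{0..1}. det (u t) = cis (\<theta> t)) \<and> m = \<theta> 1 - \<theta> 0)"

text \<open>A logarithm exists on a contractible domain, and its imaginary part is the lift.
  Convexity covers both the interval and the square of a homotopy.\<close>

lemma continuous_cis_lift:
  fixes f :: "'a::real_normed_vector \<Rightarrow> complex"
  assumes "continuous_on S f" "convex S" "\<And>x. x \<in> S \<Longrightarrow> cmod (f x) = 1"
  obtains \<theta> where "continuous_on S \<theta>" "\<And>x. x \<in> S \<Longrightarrow> f x = cis (\<theta> x)"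
proof -
  obtain g where g: "continuous_on S g" "\<And>x. x \<in> S \<Longrightarrow> f x = exp (g x)"
    by (rule continuous_logarithm_on_contractible [OF assms(1) convex_imp_contractible [OF assms(2)]])
       (use assms(3) in fastforce)+
  have "f x = cis (Im (g x))" if "x \<in> S" for x
    using assms(3) [OF that] g(2) [OF that] by (simp add: exp_eq_polar norm_mult)
  then show thesis
    using that [of "\<lambda>x. Im (g x)"] g(1) by (auto intro: continuous_intros)
qed

lemma winding_exists:
  assumes "upath u" shows "\<exists>m. winding u m"
proof -
  obtain \<theta> where "continuous_on {0..1} \<theta>" "\<And>t. t \<in> {0..1} \<Longrightarrow> det (u t) = cis (\<theta> t)"
    by (rule continuous_cis_lift [of "{0..1}" "\<lambda>t. det (u t)"])
       (use upathD [OF assms] in \<open>auto intro: continuous_on_det unitary_det\<close>)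
  then show ?thesis unfolding winding_def by blast
qed

text \<open>The determinant of the whole homotopy is lifted over the square. Two opposite edges
  carry lifts for \<open>u\<close> and \<open>v\<close>; along the other two the determinant is
  constant, hence so is the lift, and the increments agree.\<close>

lemma winding_homotopic:
  assumes hom: "homotopic_paths unitary_group u v" and "winding u m" "winding v k"
  shows "m = k"
proof -
  obtain \<alpha> where \<alpha>: "continuous_on {0..1} \<alpha>" "\<forall>t\<in>{0..1}. det (u t) = cis (\<alpha> t)" "m = \<alpha> 1 - \<alpha> 0"
    using assms(2) unfolding winding_def by blast
  obtain \<beta> where \<beta>: "continuous_on {0..1} \<beta>" "\<forall>t\<in>{0..1}. det (v t) = cis (\<beta> t)" "k = \<beta> 1 - \<beta> 0"
    using assms(3) unfolding winding_def by blast
  obtain H :: "real \<Rightarrow> real \<Rightarrow> _" where H: "continuous_on ({0..1} \<times> {0..1}) (\<lambda>x. H (fst x) (snd x))"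
    "\<And>s t. s \<in> {0..1} \<Longrightarrow> t \<in> {0..1} \<Longrightarrow> H s t \<in> unitary_group"
    "\<And>t. t \<in> {0..1} \<Longrightarrow> H 0 t = u t" "\<And>t. t \<in> {0..1} \<Longrightarrow> H 1 t = v t"
    "\<And>s. s \<in> {0..1} \<Longrightarrow> H s 0 = u 0" "\<And>s. s \<in> {0..1} \<Longrightarrow> H s 1 = u 1"
    using homotopic_pathsE [OF hom] by blast
  obtain \<theta> where \<theta>: "continuous_on ({0..1} \<times> {0..1}) \<theta>"
      "\<And>x. x \<in> {0..1} \<times> {0..1} \<Longrightarrow> det (H (fst x) (snd x)) = cis (\<theta> x)"
    by (rule continuous_cis_lift [of "{0..1::real} \<times> {0..1::real}" "\<lambda>x. det (H (fst x) (snd x))"])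
       (use H in \<open>auto intro!: continuous_on_det unitary_det convex_Times\<close>)
  have cont1: "continuous_on {0..1} (\<lambda>t. \<theta> (s, t))" "continuous_on {0..1} (\<lambda>t. \<theta> (t, s))"
    if "s \<in> {0..1}" for s
    using that by (intro continuous_on_compose2 [OF \<theta>(1)] continuous_intros; auto)+
  have "\<alpha> 1 - \<alpha> 0 = \<theta> (0, 1) - \<theta> (0, 0)"
    by (rule cis_lift_unique [of "{0..1}"])
       (use \<alpha> \<theta>(2) cont1 H in \<open>auto simp flip: \<theta>(2)\<close>)
  moreover have "\<beta> 1 - \<beta> 0 = \<theta> (1, 1) - \<theta> (1, 0)"
    by (rule cis_lift_unique [of "{0..1}"])
       (use \<beta> \<theta>(2) cont1 H in \<open>auto simp flip: \<theta>(2)\<close>)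
  moreover have "\<theta> (1, e) = \<theta> (0, e)" if e: "e = 0 \<or> e = 1" for e
  proof -
    have "\<theta> (1, e) - \<theta> (0, e) = \<theta> (0, e) - \<theta> (0, e)"
    proof (rule cis_lift_unique [of "{0..1}" "\<lambda>s. \<theta> (s, e)" "\<lambda>s. \<theta> (0, e)"])
      fix s :: real assume "s \<in> {0..1}"
      then show "cis (\<theta> (s, e)) = cis (\<theta> (0, e))"
        using e \<theta>(2) [of "(s, e)"] \<theta>(2) [of "(0, e)"] H(5,6) [of s] H(5,6) [of 0] by auto
    qed (use e cont1(2) in auto)
    then show ?thesis by simp
  qed
  ultimately show ?thesis using \<alpha>(3) \<beta>(3) by simp
qed

lemma winding_mult:
  assumes "winding u m" "winding v k" shows "winding (\<lambda>t. u t ** v t) (m + k)"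
proof -
  obtain \<alpha> where \<alpha>: "continuous_on {0..1} \<alpha>" "\<forall>t\<in>{0..1}. det (u t) = cis (\<alpha> t)" "m = \<alpha> 1 - \<alpha> 0"
    using assms(1) unfolding winding_def by blast
  obtain \<beta> where \<beta>: "continuous_on {0..1} \<beta>" "\<forall>t\<in>{0..1}. det (v t) = cis (\<beta> t)" "k = \<beta> 1 - \<beta> 0"
    using assms(2) unfolding winding_def by blast
  show ?thesis
    unfolding winding_def
    by (rule exI [of _ "\<lambda>t. \<alpha> t + \<beta> t"])
       (use \<alpha> \<beta> in \<open>auto intro: continuous_intros simp: det_mul cis_mult\<close>)
qed

lemma winding_cadj:
  assumes "winding u m" shows "winding (\<lambda>t. cadj (u t)) (- m)"
proof -
  obtain \<alpha> where \<alpha>: "continuous_on {0..1} \<alpha>" "\<forall>t\<in>{0..1}. det (u t) = cis (\<alpha> t)" "m = \<alpha> 1 - \<alpha> 0"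
    using assms(1) unfolding winding_def by blast
  show ?thesis
    unfolding winding_def
    by (rule exI [of _ "\<lambda>t. - \<alpha> t"])
       (use \<alpha> in \<open>auto intro: continuous_intros simp: det_cadj cis_cnj\<close>)
qed

section \<open>The group of homotopy classes and \<open>mu\<close>\<close>

lemma cls_self: "upath u \<Longrightarrow> u \<in> cls u"
  by (simp add: cls_def upath_def)

lemma cls_eq: "homotopic_paths unitary_group u v \<Longrightarrow> cls u = cls v"
  unfolding cls_def using homotopic_paths_sym homotopic_paths_trans by blast

lemma UC_E:
  assumes "f \<in> UC" obtains u where "upath u" "f = cls u"
  using assms by (auto simp: UC_def)

lemma UC_member:
  assumes "f \<in> UC" "v \<in> f" shows "upath v" "f = cls v"
proof -
  obtain u where u: "upath u" "f = cls u" using assms(1) by (rule UC_E)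
  then have "homotopic_paths unitary_group u v" using assms(2) by (simp add: cls_def)
  then show "upath v" "f = cls v" using u upath_homotopic cls_eq by blast+
qed

text \<open>\<open>rep\<close> picks an arbitrary member, so the group operations are evaluated on a
  given path through this homotopy.\<close>

lemma rep_homotopic:
  assumes "upath u" shows "homotopic_paths unitary_group u (rep (cls u))"
  using someI [of "\<lambda>v. v \<in> cls u" u] cls_self [OF assms]
  by (simp add: rep_def cls_def)

lemma cls_UC: "upath u \<Longrightarrow> cls u \<in> UC"
  by (auto simp: UC_def)

lemma amul_cls:
  assumes "upath u" "upath v" shows "amul (cls u) (cls v) = cls (\<lambda>t. u t ** v t)"
  unfolding amul_def
  by (rule cls_eq, rule homotopic_mult)
     (use assms rep_homotopic homotopic_paths_sym in blast)+

lemma ainv_cls: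
  assumes "upath u" shows "ainv (cls u) = cls (\<lambda>t. cadj (u t))"
  unfolding ainv_def
  by (rule cls_eq, rule homotopic_cadj)
     (use assms rep_homotopic homotopic_paths_sym in blast)

lemma mu_cls:
  assumes "upath u" "winding u m" shows "mu (cls u) = m"
proof -
  have *: "mu (cls u) = (THE m. \<exists>v\<in>cls u. winding v m)"
    by (simp add: mu_def winding_def)
  show ?thesis
    unfolding *
  proof (rule the_equality)
    show "\<exists>v\<in>cls u. winding v m" using assms cls_self by blast
    fix k assume "\<exists>v\<in>cls u. winding v k"
    then show "k = m" using assms winding_homotopic by (auto simp: cls_def)
  qed
qed

lemma amul_UC:
  assumes "f \<in> UC" "g \<in> UC" shows "amul f g \<in> UC" "mu (amul f g) = mu f + mu g"
proof -
  obtain u v where uv: "upath u" "f = cls u" "upath v" "g = cls v"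
    using assms by (meson UC_E)
  obtain m k where "winding u m" "winding v k"
    using winding_exists uv by blast
  then show "amul f g \<in> UC" "mu (amul f g) = mu f + mu g"
    using uv by (simp_all add: amul_cls cls_UC upath_mult mu_cls winding_mult
        mu_cls [OF upath_mult winding_mult])
qed

lemma ainv_UC:
  assumes "f \<in> UC" shows "ainv f \<in> UC" "mu (ainv f) = - mu f"
proof -
  obtain u where u: "upath u" "f = cls u" using assms by (meson UC_E)
  obtain m where "winding u m" using winding_exists u by blast
  then show "ainv f \<in> UC" "mu (ainv f) = - mu f"
    using u by (simp_all add: ainv_cls cls_UC upath_cadj mu_cls mu_cls [OF upath_cadj winding_cadj])
qed

lemma aone_UC: "aone \<in> UC" "mu aone = 0"
proof -
  have u: "upath (\<lambda>t. mat 1)" by (simp add: upath_iff)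
  moreover have "winding (\<lambda>t. mat 1 :: complex^'n^'n) 0"
    unfolding winding_def by (rule exI [of _ "\<lambda>t. 0"]) auto
  ultimately show "aone \<in> UC" "mu (aone :: (real \<Rightarrow> complex^'n^'n) set) = 0"
    unfolding aone_def using mu_cls cls_UC by blast+
qed

lemma amul_funpow_UC:
  assumes "f \<in> UC"
  shows "(amul f ^^ k) aone \<in> UC \<and> mu ((amul f ^^ k) aone) = real k * mu f"
  by (induction k) (simp_all add: aone_UC amul_UC assms algebra_simps)

lemma apow_UC:
  assumes "f \<in> UC" shows "apow f p \<in> UC" "mu (apow f p) = of_int p * mu f"
  using amul_funpow_UC [OF assms] amul_funpow_UC [OF ainv_UC(1) [OF assms]]
  by (simp_all add: apow_def ainv_UC assms)

section \<open>Hamiltonian paths\<close>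

lemma bounded_bilinear_matrix_mult:
  "bounded_bilinear ((**) :: complex^'n^'n \<Rightarrow> complex^'n^'n \<Rightarrow> complex^'n^'n)"
  unfolding bilinear_conv_bounded_bilinear [symmetric] bilinear_def
  by (auto intro!: linearI simp: vec_eq_iff matrix_matrix_mult_def sum.distrib scaleR_sum_right
      algebra_simps)

lemmas has_vector_derivative_matrix_mult =
  bounded_bilinear.has_vector_derivative [OF bounded_bilinear_matrix_mult]

lemma has_vector_derivative_entry:
  fixes M :: "real \<Rightarrow> complex^'n^'n"
  assumes "(M has_vector_derivative X) F"
  shows "((\<lambda>s. M s $ i $ j) has_vector_derivative X $ i $ j) F"
proof -
  have "bounded_linear (\<lambda>A::complex^'n^'n. A $ i $ j)"
    using bounded_linear_compose [OF bounded_linear_vec_nth bounded_linear_vec_nth] .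
  from bounded_linear.has_vector_derivative [OF this assms] show ?thesis .
qed

text \<open>Jacobi's formula at the identity, by differentiating the Leibniz expansion; other points
  are reached by translation.\<close>

lemma det_has_vector_derivative_at_mat1:
  fixes M :: "real \<Rightarrow> complex^'n^'n"
  assumes M: "(M has_vector_derivative X) (at t within S)" and "M t = mat 1"
  shows "((\<lambda>s. det (M s)) has_vector_derivative trace X) (at t within S)"
proof -
  have e: "((\<lambda>s. M s $ i $ j) has_derivative (\<lambda>y. y *\<^sub>R X $ i $ j)) (at t within S)" for i j
    using has_vector_derivative_entry [OF M, of i j] by (simp add: has_vector_derivative_def)
  let ?P = "{p. p permutes (UNIV :: 'n set)}"
  let ?D = "\<lambda>p y. of_int (sign p) *
     (\<Sum>i\<in>UNIV. (y *\<^sub>R X $ i $ p i) * (\<Prod>j\<in>UNIV - {i}. M t $ j $ p j))"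
  have d: "((\<lambda>s. det (M s)) has_derivative (\<lambda>y. \<Sum>p\<in>?P. ?D p y)) (at t within S)"
    unfolding det_def by (intro derivative_intros e)
  \<comment> \<open>A permutation other than the identity moves at least two indices, so even with one factor
    removed the product still contains an off-diagonal entry of \<open>M t = I\<close>.\<close>
  have off: "?D p y = 0" if p: "p \<in> ?P - {id}" for p y
  proof -
    obtain j where j: "p j \<noteq> j" using p by fastforce
    have "p (p j) \<noteq> p j"
      using p j by (metis Diff_iff mem_Collect_eq permutes_inj injD)
    then have "\<exists>j\<in>UNIV - {i}. p j \<noteq> j" for i
      using j by (metis DiffI UNIV_I singletonD)
    then have z: "(\<Prod>j\<in>UNIV - {i}. M t $ j $ p j) = 0" for i
      by (subst prod_zero_iff) (auto simp: assms(2) mat_def, metis)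
    show ?thesis unfolding z by simp
  qed
  have "(\<Sum>p\<in>?P. ?D p y) = y *\<^sub>R trace X" for y
  proof -
    have "(\<Sum>p\<in>?P. ?D p y) = ?D id y + (\<Sum>p\<in>?P - {id}. ?D p y)"
      by (rule sum.remove) (auto simp: permutes_id finite_permutations)
    also have "\<dots> = ?D id y" using off by simp
    also have "\<dots> = y *\<^sub>R trace X"
      by (simp add: assms(2) mat_def trace_def scaleR_sum_right)
    finally show ?thesis .
  qed
  then show ?thesis using d by (simp add: has_vector_derivative_def)
qed

lemma hermitian_trace_real:
  assumes "hermitian H" shows "trace H = of_real (Re (trace H))"
proof -
  have "cnj (H $ i $ i) = H $ i $ i" for i
    using arg_cong [OF assms [unfolded hermitian_def],
      of "\<lambda>A. A $ i $ i"] by (simp add: cadj_def)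
  then have "cnj (trace H) = trace H" by (simp add: trace_def)
  then show ?thesis by (metis Reals_cnj_iff of_real_Re)
qed

lemma trace_smult_ii: "trace (\<chi> i j. \<i> * H $ i $ j) = \<i> * trace (H :: complex^'n^'n)"
  by (simp add: trace_def sum_distrib_left)

text \<open>Right multiplication by the constant matrix \<open>cadj (u t)\<close> makes the path
  pass through the identity at time \<open>t\<close>, where the derivative of the determinant is a
  trace.\<close>

lemma hamiltonian_det_derivative:
  assumes U: "\<And>t. t \<in> {0..1} \<Longrightarrow> u t \<in> unitary_group" and "hamiltonian_path u h" "t \<in> {0..1}"
  shows "((\<lambda>s. det (u s)) has_vector_derivative \<i> * of_real (Re (trace (h t))) * det (u t))
    (at t within {0..1})"
proof -
  obtain u' where u': "(u has_vector_derivative u' t) (at t within {0..1})"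
     "u' t ** cadj (u t) = (\<chi> i j. \<i> * h t $ i $ j)" "hermitian (h t)"
    using assms(2,3) unfolding hamiltonian_path_def by blast
  have zero: "A ** 0 = (0 :: complex^'n^'n)" for A :: "complex^'n^'n"
    by (simp add: vec_eq_iff matrix_matrix_mult_def)
  have "((\<lambda>s. u s ** cadj (u t)) has_vector_derivative (u t ** 0 + u' t ** cadj (u t)))
      (at t within {0..1})"
    by (rule has_vector_derivative_matrix_mult [OF u'(1)]) auto
  then have "((\<lambda>s. det (u s ** cadj (u t))) has_vector_derivative trace (u' t ** cadj (u t)))
      (at t within {0..1})"
    by (intro det_has_vector_derivative_at_mat1)
       (use U assms(3) in \<open>simp_all add: zero unitary_right\<close>)
  then have "((\<lambda>s. det (u s ** cadj (u t)) * det (u t)) has_vector_derivative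
      trace (u' t ** cadj (u t)) * det (u t)) (at t within {0..1})"
    by (rule has_vector_derivative_mult_left)
  moreover have "det (u s ** cadj (u t)) * det (u t) = det (u s)" for s
    unfolding det_mul [symmetric]
    by (simp only: matrix_mul_assoc [symmetric] unitary_left [OF U [OF assms(3)]] matrix_mul_rid)
  moreover have "trace (u' t ** cadj (u t)) = \<i> * of_real (Re (trace (h t)))"
    unfolding u'(2) trace_smult_ii by (subst hermitian_trace_real [OF u'(3)]) (rule HOL.refl)
  ultimately show ?thesis by simp
qed

text \<open>Continuity is inherited from the derivative of \<open>u\<close>, since
  \<open>Re (trace (h t))\<close> is the imaginary part of the trace of
  \<open>u' t ** cadj (u t)\<close>.\<close>

lemma hamiltonian_continuous_trace:
  assumes U: "\<And>t. t \<in> {0..1} \<Longrightarrow> u t \<in> unitary_group" and "hamiltonian_path u h"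
  shows "continuous_on {0..1} (\<lambda>t. Re (trace (h t)))"
proof -
  obtain u' where u': "continuous_on {0..1} u'"
     "\<And>t. t \<in> {0..1} \<Longrightarrow> (u has_vector_derivative u' t) (at t within {0..1})"
     "\<And>t. t \<in> {0..1} \<Longrightarrow> u' t ** cadj (u t) = (\<chi> i j. \<i> * h t $ i $ j)"
    using assms(2) unfolding hamiltonian_path_def by blast
  have "continuous_on {0..1} u"
    using u'(2) has_vector_derivative_continuous continuous_on_eq_continuous_within by blast
  then have "continuous_on {0..1} (\<lambda>t. Im (trace (u' t ** cadj (u t))))"
    unfolding trace_def by (intro continuous_intros u')
  then show ?thesis
    by (rule continuous_on_eq) (simp add: u'(3) trace_smult_ii)
qed

lemma winding_hamiltonian:
  assumes U: "\<And>t. t \<in> {0..1} \<Longrightarrow> u t \<in> unitary_group" and ham: "hamiltonian_path u h"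
  shows "winding u (integral {0..1} (\<lambda>t. Re (trace (h t))))"
proof -
  define \<theta> where "\<theta> t = integral {0..t} (\<lambda>t. Re (trace (h t)))" for t
  note cont = hamiltonian_continuous_trace [OF assms]
  have \<theta>: "(\<theta> has_vector_derivative Re (trace (h t))) (at t within {0..1})" if "t \<in> {0..1}" for t
    unfolding \<theta>_def by (rule integral_has_vector_derivative [OF cont that])
  have \<theta>c: "continuous_on {0..1} \<theta>"
    using \<theta> has_vector_derivative_continuous continuous_on_eq_continuous_within by blast
  \<comment> \<open>Dividing the determinant by the expected phase leaves a function with zero
    derivative, hence a constant of modulus one; its argument is the initial angle.\<close>
  define g where "g t = det (u t) * cis (- \<theta> t)" for t
  have g: "(g has_derivative (\<lambda>h. 0)) (at t within {0..1})" if t: "t \<in> {0..1}" for t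
  proof -
    have "((\<lambda>x. - \<theta> x) has_derivative (\<lambda>y. - (y *\<^sub>R Re (trace (h t))))) (at t within {0..1})"
      using \<theta> [OF t] by (auto intro: derivative_intros simp: has_vector_derivative_def)
    from has_derivative_mult [OF hamiltonian_det_derivative [OF assms t, unfolded has_vector_derivative_def]
        has_derivative_cis [OF this]]
    show ?thesis
      unfolding g_def by (simp add: algebra_simps scaleR_conv_of_real)
  qed
  obtain c where c: "\<And>t. t \<in> {0..1} \<Longrightarrow> g t = c"
    using has_derivative_zero_constant [of "{0..1}" g] g by auto
  have c1: "cmod c = 1"
    using c [of 0] unitary_det [OF U, of 0] by (auto simp: g_def norm_mult)
  obtain \<alpha> where \<alpha>: "c = cis \<alpha>"
  proof
    show "c = cis (Arg c)" using c1 cis_Arg [of c] by (cases "c = 0") (auto simp: sgn_div_norm)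
  qed
  have "det (u t) = cis (\<alpha> + \<theta> t)" if "t \<in> {0..1}" for t
  proof -
    have "det (u t) = g t * cis (\<theta> t)" by (simp add: g_def cis_mult mult.assoc)
    then show ?thesis using c [OF that] \<alpha> by (simp add: cis_mult)
  qed
  moreover have "\<theta> 1 - \<theta> 0 = integral {0..1} (\<lambda>t. Re (trace (h t)))"
    by (simp add: \<theta>_def)
  moreover have "continuous_on {0..1} (\<lambda>t. \<alpha> + \<theta> t)"
    by (intro continuous_intros \<theta>c)
  ultimately show ?thesis
    unfolding winding_def by (intro exI [of _ "\<lambda>t. \<alpha> + \<theta> t"]) auto
qed

section \<open>Positive paths and their products\<close>

text \<open>The condition in \<open>ageq\<close>, read on a path that represents the quotient of the
  two classes.\<close>

definition positive_path :: "(real \<Rightarrow> complex^'n^'n) \<Rightarrow> bool" where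
  "positive_path u \<longleftrightarrow> (\<exists>w h. homotopic_paths unitary_group u w \<and> hamiltonian_path w h \<and>
     (\<forall>t\<in>{0..1}. pos_semidef (h t)))"

lemma positive_path_homotopic:
  "homotopic_paths unitary_group u v \<Longrightarrow> positive_path v \<Longrightarrow> positive_path u"
  unfolding positive_path_def using homotopic_paths_trans by blast

lemma hermitian_add: "hermitian A \<Longrightarrow> hermitian B \<Longrightarrow> hermitian (A + B)"
  by (simp add: hermitian_def cadj_def vec_eq_iff)

lemma hermitian_conj: "hermitian A \<Longrightarrow> hermitian (U ** A ** cadj U)"
  by (simp add: hermitian_def cadj_mult matrix_mul_assoc)

lemma pos_semidef_add:
  assumes "pos_semidef A" "pos_semidef B" shows "pos_semidef (A + B)"
proof -
  have "qform (A + B) x = qform A x + qform B x" for x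
    by (simp add: qform_cin cin_add_right matrix_vector_mult_add_rdistrib)
  then show ?thesis using assms by (simp add: pos_semidef_def hermitian_add)
qed

lemma pos_semidef_conj:
  assumes "pos_semidef A" shows "pos_semidef (U ** A ** cadj U)"
proof -
  have "qform (U ** A ** cadj U) x = qform A (cadj U *v x)" for x
    using cin_matrix_left [of "cadj U" x "A *v (cadj U *v x)"]
    by (simp add: qform_cin matrix_vector_mul_assoc matrix_mul_assoc)
  then show ?thesis using assms by (simp add: pos_semidef_def hermitian_conj)
qed

text \<open>By the product rule the generator of the product is that of \<open>u\<close> plus that
  of \<open>v\<close> conjugated by \<open>u\<close>; sums and conjugations both preserve
  semidefiniteness.\<close>

lemma hamiltonian_mult:
  fixes u v :: "real \<Rightarrow> complex^'n^'n"
  assumes u: "\<And>t. t \<in> {0..1} \<Longrightarrow> u t \<in> unitary_group"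
    and v: "\<And>t. t \<in> {0..1} \<Longrightarrow> v t \<in> unitary_group"
    and "hamiltonian_path u hu" "hamiltonian_path v hv"
  shows "hamiltonian_path (\<lambda>t. u t ** v t) (\<lambda>t. hu t + u t ** hv t ** cadj (u t))"
proof -
  obtain u' where u': "continuous_on {0..1} u'"
     "\<And>t. t \<in> {0..1} \<Longrightarrow> (u has_vector_derivative u' t) (at t within {0..1})"
     "\<And>t. t \<in> {0..1} \<Longrightarrow> u' t ** cadj (u t) = (\<chi> i j. \<i> * hu t $ i $ j)"
     "\<And>t. t \<in> {0..1} \<Longrightarrow> hermitian (hu t)"
    using assms(3) unfolding hamiltonian_path_def by blast
  obtain v' where v': "continuous_on {0..1} v'"
     "\<And>t. t \<in> {0..1} \<Longrightarrow> (v has_vector_derivative v' t) (at t within {0..1})"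
     "\<And>t. t \<in> {0..1} \<Longrightarrow> v' t ** cadj (v t) = (\<chi> i j. \<i> * hv t $ i $ j)"
     "\<And>t. t \<in> {0..1} \<Longrightarrow> hermitian (hv t)"
    using assms(4) unfolding hamiltonian_path_def by blast
  have cont: "continuous_on {0..1} u" "continuous_on {0..1} v"
    using u'(2) v'(2) has_vector_derivative_continuous continuous_on_eq_continuous_within by blast+
  have smult: "A ** (\<chi> i j. \<i> * H $ i $ j) ** B = (\<chi> i j. \<i> * (A ** H ** B) $ i $ j)"
    for A H B :: "complex^'n^'n"
    by (simp add: vec_eq_iff matrix_matrix_mult_def sum_distrib_left sum_distrib_right mult.left_commute
        mult.assoc)
  show ?thesis
    unfolding hamiltonian_path_def
  proof (intro exI [of _ "\<lambda>t. u t ** v' t + u' t ** v t"] conjI ballI)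
    show "continuous_on {0..1} (\<lambda>t. u t ** v' t + u' t ** v t)"
      by (intro continuous_intros u' v' cont)
    fix t :: real assume t: "t \<in> {0..1}"
    show "((\<lambda>t. u t ** v t) has_vector_derivative u t ** v' t + u' t ** v t) (at t within {0..1})"
      using has_vector_derivative_matrix_mult [OF u'(2) v'(2), OF t t] .
    have "(u t ** v' t + u' t ** v t) ** cadj (u t ** v t)
        = u t ** (v' t ** cadj (v t)) ** cadj (u t) + u' t ** (v t ** cadj (v t)) ** cadj (u t)"
      by (simp add: cadj_mult bounded_bilinear.add_left [OF bounded_bilinear_matrix_mult] matrix_mul_assoc)
    also have "\<dots> = (\<chi> i j. \<i> * (hu t + u t ** hv t ** cadj (u t)) $ i $ j)"
      unfolding v'(3) [OF t] smult unitary_right [OF v [OF t]] matrix_mul_rid u'(3) [OF t]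
      by (simp add: vec_eq_iff algebra_simps)
    finally show "(u t ** v' t + u' t ** v t) ** cadj (u t ** v t)
        = (\<chi> i j. \<i> * (hu t + u t ** hv t ** cadj (u t)) $ i $ j)" .
    show "hermitian (hu t + u t ** hv t ** cadj (u t))"
      using u'(4) v'(4) t by (intro hermitian_add hermitian_conj)
  qed
qed

lemma positive_path_mult:
  assumes "positive_path u" "positive_path v"
  shows "positive_path (\<lambda>t. u t ** v t)"
proof -
  obtain a hu where a: "homotopic_paths unitary_group u a" "hamiltonian_path a hu"
     "\<forall>t\<in>{0..1}. pos_semidef (hu t)"
    using assms(1) unfolding positive_path_def by blast
  obtain b hv where b: "homotopic_paths unitary_group v b" "hamiltonian_path b hv"
     "\<forall>t\<in>{0..1}. pos_semidef (hv t)"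
    using assms(2) unfolding positive_path_def by blast
  have ab: "\<And>t. t \<in> {0..1} \<Longrightarrow> a t \<in> unitary_group" "\<And>t. t \<in> {0..1} \<Longrightarrow> b t \<in> unitary_group"
    using homotopic_paths_imp_subset a(1) b(1) by (fastforce simp: path_image_def)+
  show ?thesis
    unfolding positive_path_def
    by (intro exI conjI)
       (rule homotopic_mult [OF a(1) b(1)], rule hamiltonian_mult [OF ab a(2) b(2)],
        use a(3) b(3) in \<open>auto intro: pos_semidef_add pos_semidef_conj\<close>)
qed

section \<open>One-parameter groups of reflections\<close>

definition outer :: "complex^'n \<Rightarrow> complex \<Rightarrow> complex^'n^'n" where
  "outer v c = (\<chi> i j. c * v $ i * cnj (v $ j))"

lemma outer_vec: "outer v c *v x = (c * cin v x) *s v"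
  by (simp add: outer_def vec_eq_iff matrix_vector_mult_def cin_def sum_distrib_left
      sum_distrib_right algebra_simps)

lemma reflection_eq_outer: "reflection v z = mat 1 + outer v (z - 1)"
  by (simp add: reflection_def outer_def mat_def vec_eq_iff)

lemma bounded_linear_outer: "bounded_linear (outer v)"
  unfolding linear_conv_bounded_linear [symmetric]
  by (rule linearI) (simp_all add: outer_def vec_eq_iff algebra_simps)

lemma outer_mult_refl:
  assumes "norm v = 1" shows "outer v c ** reflection v w = outer v (c * w)"
proof -
  have "(outer v c ** reflection v w) *v x = outer v (c * w) *v x" for x
    by (simp add: matrix_vector_mul_assoc [symmetric] reflection_vec outer_vec cin_add_right cin_smult_right
        cin_unit assms) (simp add: vec_eq_iff algebra_simps)
  then show ?thesis by (simp add: matrix_eq)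
qed

lemma hermitian_outer: "hermitian (outer v (of_real r))"
  by (simp add: hermitian_def cadj_def outer_def vec_eq_iff)

lemma pos_semidef_outer:
  assumes "0 \<le> r" shows "pos_semidef (outer v (of_real r))"
proof -
  have "qform (outer v (of_real r)) x = of_real (r * (cmod (cin v x))\<^sup>2)" for x
    using complex_norm_square [of "cin v x"]
    by (simp add: qform_cin outer_vec cin_smult_right cin_commute [of x v])
  then show ?thesis using assms by (simp add: pos_semidef_def hermitian_outer)
qed

lemma trace_outer:
  assumes "norm v = 1" shows "trace (outer v c) = c"
proof -
  have "trace (outer v c) = c * cin v v"
    by (simp add: trace_def outer_def cin_def sum_distrib_left ac_simps)
  then show ?thesis by (simp add: cin_unit assms)
qed

lemma upath_refl:
  assumes "norm v = 1" shows "upath (\<lambda>s. reflection v (cis (s * r)))"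
  by (rule upathI) (use assms in \<open>auto intro!: continuous_intros reflection_unitary\<close>)

text \<open>The derivative is a rank-one matrix carrying the phase of the current reflection;
  multiplication by the adjoint cancels this phase, so the generator is constant.\<close>

lemma hamiltonian_refl:
  assumes "norm v = 1"
  shows "hamiltonian_path (\<lambda>s. reflection v (cis (s * r))) (\<lambda>s. outer v (of_real r))"
  unfolding hamiltonian_path_def
proof (intro exI [of _ "\<lambda>s. outer v (r *\<^sub>R (\<i> * cis (s * r)))"] conjI ballI)
  show "continuous_on {0..1} (\<lambda>s. outer v (r *\<^sub>R (\<i> * cis (s * r))))"
    unfolding outer_def by (intro continuous_intros)
  fix t :: real
  have "((\<lambda>s. s * r) has_derivative (\<lambda>y. y * r)) (at t within {0..1})"
    by (intro derivative_eq_intros) auto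
  from has_derivative_cis [OF this]
  have "((\<lambda>s. cis (s * r)) has_vector_derivative r *\<^sub>R (\<i> * cis (t * r))) (at t within {0..1})"
    by (simp add: has_vector_derivative_def mult.commute)
  then have "((\<lambda>s. cis (s * r) - 1) has_vector_derivative r *\<^sub>R (\<i> * cis (t * r)) - 0) (at t within {0..1})"
    by (intro has_vector_derivative_diff has_vector_derivative_const)
  then have "((\<lambda>s. outer v (cis (s * r) - 1)) has_vector_derivative outer v (r *\<^sub>R (\<i> * cis (t * r))))
       (at t within {0..1})"
    using bounded_linear.has_vector_derivative [OF bounded_linear_outer] by fastforce
  then have "((\<lambda>s. mat 1 + outer v (cis (s * r) - 1)) has_vector_derivative
       0 + outer v (r *\<^sub>R (\<i> * cis (t * r)))) (at t within {0..1})"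
    by (intro has_vector_derivative_add has_vector_derivative_const)
  then show "((\<lambda>s. reflection v (cis (s * r))) has_vector_derivative outer v (r *\<^sub>R (\<i> * cis (t * r))))
       (at t within {0..1})"
    by (simp add: reflection_eq_outer)
  show "outer v (r *\<^sub>R (\<i> * cis (t * r))) ** cadj (reflection v (cis (t * r)))
       = (\<chi> i j. \<i> * outer v (of_real r) $ i $ j)"
    by (simp add: cadj_refl outer_mult_refl assms cis_cnj mult.assoc cis_mult scaleR_conv_of_real)
       (simp add: outer_def mult.left_commute mult.assoc)
  show "hermitian (outer v (complex_of_real r))" by (rule hermitian_outer)
qed

lemma winding_refl:
  assumes "norm v = 1" shows "winding (\<lambda>s. reflection v (cis (s * r))) r"
  using winding_hamiltonian [OF upathD(2) [OF upath_refl [OF assms]] hamiltonian_refl [OF assms], of r]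
  by (simp add: trace_outer assms)

lemma positive_refl:
  assumes "norm v = 1" "0 \<le> r" shows "positive_path (\<lambda>s. reflection v (cis (s * r)))"
  unfolding positive_path_def
  using upath_homotopic_refl [OF upath_refl [OF assms(1)]] hamiltonian_refl [OF assms(1)]
    pos_semidef_outer [OF assms(2)]
  by blast

text \<open>Full turns end at the identity whatever their axis, so moving the axis along a path in
  the unit sphere keeps both endpoints fixed.\<close>

lemma full_turn_homotopic:
  fixes v w :: "complex^'n"
  assumes "norm v = 1" "norm w = 1"
  shows "homotopic_paths unitary_group (\<lambda>s. reflection v (cis (s * (2 * pi * of_int k))))
     (\<lambda>s. reflection w (cis (s * (2 * pi * of_int k))))"
proof -
  \<comment> \<open>The real dimension is at least two even for one complex coordinate, so the unit
    sphere is path connected.\<close>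
  have "2 \<le> DIM(complex^'n)" by simp
  then have "path_connected (sphere (0::complex^'n) 1)"
    by (rule path_connected_sphere)
  then obtain g where g: "path g" "path_image g \<subseteq> sphere 0 1" "pathstart g = v" "pathfinish g = w"
    using assms unfolding path_connected_def by (metis mem_sphere_0)
  have gn: "norm (g s) = 1" if "s \<in> {0..1}" for s
    using g(2) that by (force simp: path_image_def)
  have full: "cis (2 * pi * of_int k) = 1"
    by (rule cis_multiple_2pi) simp
  have gc: "continuous_on ({0..1} \<times> {0..1}) (\<lambda>x::real \<times> real. g (fst x))"
    by (rule continuous_on_compose2 [OF g(1) [unfolded path_def]]) (auto intro: continuous_on_fst)
  show ?thesis
  proof (rule homotopic_pathsI [where H = "\<lambda>a s. reflection (g a) (cis (s * (2 * pi * of_int k)))"])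
    show "continuous_on ({0..1} \<times> {0..1}) (\<lambda>x. reflection (g (fst x)) (cis (snd x * (2 * pi * of_int k))))"
      by (intro continuous_intros gc)
  qed (use g gn full in \<open>auto intro: reflection_unitary simp: pathstart_def pathfinish_def\<close>)
qed

section \<open>Paths with large determinant angle are positive\<close>

lemma cin_axis_left [simp]: "cin (axis j 1) x = x $ j"
  by (simp add: cin_def axis_def if_distrib [of cnj] if_distrib [of "\<lambda>c. c * _"] cong: if_cong)

lemma cin_axis_right [simp]: "cin x (axis j 1) = cnj (x $ j)"
  by (subst cin_commute) simp

text \<open>Among unitary matrices this is a smaller unitary group on the coordinates outside
  \<open>S\<close>. Keeping it inside the full matrix type allows induction on the dimension without
  changing types.\<close>

definition fixes_axes :: "'n set \<Rightarrow> complex^'n^'n \<Rightarrow> bool" where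
  "fixes_axes S U \<longleftrightarrow> (\<forall>j\<in>S. U *v axis j 1 = axis j 1)"

lemma fixes_axes_mult: "fixes_axes S U \<Longrightarrow> fixes_axes S V \<Longrightarrow> fixes_axes S (U ** V)"
  by (simp add: fixes_axes_def matrix_vector_mul_assoc [symmetric])

lemma fixes_axes_cadj: "U \<in> unitary_group \<Longrightarrow> fixes_axes S U \<Longrightarrow> fixes_axes S (cadj U)"
  by (auto simp: fixes_axes_def intro: unitary_cadj_vec)

lemma fixes_axes_column:
  assumes "U \<in> unitary_group" "fixes_axes S U" "j \<in> S" "i \<notin> S"
  shows "(U *v axis i 1) $ j = 0"
proof -
  have "(U *v axis i 1) $ j = cin (U *v axis j 1) (U *v axis i 1)"
    using assms by (simp add: fixes_axes_def)
  also have "\<dots> = cin (axis j 1) (axis i 1)"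
    by (rule unitary_cin [OF assms(1)])
  also have "\<dots> = 0"
    unfolding cin_axis_left using assms(3,4) by (auto simp: axis_def)
  finally show ?thesis .
qed

lemma fixes_axes_refl:
  assumes "\<And>j. j \<in> S \<Longrightarrow> v $ j = 0" shows "fixes_axes S (reflection v z)"
  using assms by (auto simp: fixes_axes_def intro!: reflection_fix)

lemma fixes_axes_refl_to:
  assumes "\<And>j. j \<in> S \<Longrightarrow> a $ j = 0" "\<And>j. j \<in> S \<Longrightarrow> b $ j = 0"
  shows "fixes_axes S (reflection_to a b)"
  using assms by (auto simp: fixes_axes_def intro!: reflection_to_fix)

text \<open>Between opposite unit vectors the eigenvalue is -1 in both directions and the axis spans
  the same line, so the two reflections cancel.\<close>

lemma reflection_to_neg_cancel:
  assumes "norm x = 1" shows "reflection_to (- x) x ** reflection_to x (- x) = mat 1"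
proof -
  have "- x - x = 2 *\<^sub>R (- x)" "x - (- x) = 2 *\<^sub>R x" and "sgn x = x"
    using assms by (simp_all only: scaleR_2 sgn_div_norm) simp_all
  then have "sgn (- x - x) = - x" "sgn (x - (- x)) = x"
    by (simp_all only: sgn_scaleR sgn_minus) simp_all
  moreover have "reflection (- x) z = reflection x z" for z
    by (simp add: reflection_def)
  ultimately show ?thesis
    by (simp add: reflection_to_def cin_minus_left cin_minus_right cin_unit assms reflection_mult)
qed

section \<open>Moving a column off a point of the sphere\<close>

text \<open>Differentiability excludes space-filling curves. The missed point uses only coordinates
  \<open>i\<close> and \<open>k\<close>, so it can stay orthogonal to axes that are already
  fixed.\<close>

lemma differentiable_path_avoids:
  fixes P :: "real \<Rightarrow> complex^'n"
  assumes P: "P differentiable_on {0..1}" and nz: "\<And>t. t \<in> {0..1} \<Longrightarrow> P t \<noteq> 0" and ik: "i \<noteq> k"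
  obtains q where "norm q = 1" "\<And>j. j \<noteq> i \<Longrightarrow> j \<noteq> k \<Longrightarrow> q $ j = 0"
    "\<And>t. t \<in> {0..1} \<Longrightarrow> sgn (P t) \<noteq> q"
proof -
  \<comment> \<open>One complex coordinate of \<open>sgn (P t)\<close> traces a null set, so it misses a point of the unit disc.\<close>
  define f where "f t = inverse (norm (P t)) *\<^sub>R (P t $ i)" for t
  have "f differentiable_on {0..1}"
    unfolding differentiable_on_def
  proof
    fix t :: real assume t: "t \<in> {0..1}"
    have Pt: "P differentiable (at t within {0..1})" using P t by (simp add: differentiable_on_def)
    then have 1: "(\<lambda>t. norm (P t)) differentiable (at t within {0..1})"
      using differentiable_chain_within [of P t "{0..1}" norm] nz [OF t]
      by (simp add: o_def differentiable_at_withinI)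
    have 2: "(\<lambda>t. P t $ i) differentiable (at t within {0..1})"
      using Pt bounded_linear.has_derivative [OF bounded_linear_vec_nth]
      unfolding differentiable_def by blast
    show "f differentiable (at t within {0..1})"
      unfolding f_def using 1 2 nz [OF t] by (intro differentiable_scaleR differentiable_inverse) auto
  qed
  then have "negligible (f ` {0..1})"
    by (rule negligible_differentiable_image_lowdim [rotated]) simp
  then have "\<not> ball (0::complex) 1 \<subseteq> f ` {0..1}"
    using open_not_negligible [of "ball (0::complex) 1"] negligible_subset by auto
  then obtain \<zeta> where \<zeta>: "cmod \<zeta> < 1" "\<zeta> \<notin> f ` {0..1}" by (auto simp: subset_iff)
  \<comment> \<open>The missed value \<open>\<zeta>\<close> becomes coordinate \<open>i\<close> of
    \<open>q\<close>; \<open>r\<close> in coordinate \<open>k\<close> completes it to unit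
    length.\<close>
  define r where "r = sqrt (1 - (cmod \<zeta>)\<^sup>2)"
  define q where "q = axis i \<zeta> + axis k (of_real r)"
  have r2: "r\<^sup>2 = 1 - (cmod \<zeta>)\<^sup>2"
    unfolding r_def using \<zeta>(1) by (simp add: power_le_one)
  show thesis
  proof
    have "cin q q = (\<Sum>j\<in>{i, k}. cnj (q $ j) * q $ j)"
      unfolding cin_def by (rule sum.mono_neutral_right) (auto simp: q_def axis_def)
    also have "\<dots> = cnj \<zeta> * \<zeta> + of_real r * of_real r"
      using ik by (simp add: q_def axis_def)
    also have "\<dots> = of_real ((cmod \<zeta>)\<^sup>2 + r\<^sup>2)"
      using complex_norm_square [of \<zeta>] by (simp add: power2_eq_square [of "of_real r"] mult.commute)
    also have "\<dots> = 1" by (simp add: r2)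
    finally have "(norm q)\<^sup>2 = 1" unfolding cin_self by (metis of_real_eq_1_iff)
    then show "norm q = 1" using norm_ge_zero [of q] by (simp add: power2_eq_1_iff del: norm_ge_zero)
    show "q $ j = 0" if "j \<noteq> i" "j \<noteq> k" for j using that by (simp add: q_def axis_def)
    show "sgn (P t) \<noteq> q" if "t \<in> {0..1}" for t
    proof
      assume "sgn (P t) = q"
      then have "sgn (P t) $ i = \<zeta>" using ik by (simp add: q_def axis_def)
      then have "f t = \<zeta>" by (simp add: f_def sgn_div_norm)
      then show False using \<zeta>(2) that by blast
    qed
  qed
qed

text \<open>A merely continuous column could fill the sphere. It is replaced by a normalised
  polynomial curve with the same endpoints, and the whole matrix is carried along by
  unitaries.\<close>

lemma perturb_column:
  fixes u :: "real \<Rightarrow> complex^'n^'n"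
  assumes u: "upath u" and fix_u: "\<And>t. t \<in> {0..1} \<Longrightarrow> fixes_axes S (u t)"
    and ik: "i \<notin> S" "k \<notin> S" "i \<noteq> k"
  obtains v q where "homotopic_paths unitary_group u v" "\<And>t. t \<in> {0..1} \<Longrightarrow> fixes_axes S (v t)"
    "norm q = 1" "\<And>j. j \<in> S \<Longrightarrow> q $ j = 0" "\<And>t. t \<in> {0..1} \<Longrightarrow> v t *v axis i 1 \<noteq> q"
proof -
  define c where "c t = u t *v axis i 1" for t
  have c_cont: "continuous_on {0..1} c"
    unfolding c_def using upathD(1) [OF u] by (intro continuous_intros)
  have c_norm: "norm (c t) = 1" if "t \<in> {0..1}" for t
    using upathD(2) [OF u that] by (simp add: c_def unitary_norm)
  have c_S: "c t $ j = 0" if "t \<in> {0..1}" "j \<in> S" for t j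
    using fixes_axes_column [OF upathD(2) [OF u that(1)] fix_u [OF that(1)] that(2) ik(1)]
    by (simp add: c_def)
  \<comment> \<open>The tolerance 1 is the length of \<open>c t\<close>: the segment from
    \<open>c t\<close> to the approximation then avoids zero and the direction opposite to
    \<open>c t\<close>.\<close>
  obtain p where p: "polynomial_function p" "p 0 = c 0" "p 1 = c 1"
      "\<And>t. t \<in> {0..1} \<Longrightarrow> norm (p t - c t) < 1"
    using path_approx_polynomial_function [of c 1] c_cont
    by (auto simp: path_def pathstart_def pathfinish_def)
  \<comment> \<open>Deleting the coordinates in \<open>S\<close> keeps the new column orthogonal to
    the fixed axes and does not increase the distance to \<open>c t\<close>, which vanishes
    there.\<close>
  define L :: "complex^'n \<Rightarrow> complex^'n" where "L x = (\<chi> j. if j \<in> S then 0 else x $ j)" for x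
  have L_lin: "bounded_linear L"
    unfolding linear_conv_bounded_linear [symmetric] by (rule linearI) (auto simp: L_def vec_eq_iff)
  have Lc: "L (c t) = c t" if "t \<in> {0..1}" for t
    using c_S that by (simp add: L_def vec_eq_iff)
  define P where "P t = L (p t)" for t
  have P_diff: "P differentiable_on {0..1}"
    using differentiable_on_polynomial_function [OF p(1), of "{0..1}"]
      bounded_linear.has_derivative [OF L_lin]
    unfolding differentiable_on_def differentiable_def P_def by blast
  have P_close: "norm (P t - c t) < 1" if t: "t \<in> {0..1}" for t
  proof -
    have "norm (P t - c t) \<le> norm (p t - c t)"
      by (rule norm_le_componentwise_cart) (use c_S t in \<open>auto simp: P_def L_def\<close>)
    then show ?thesis using p(4) [OF t] by linarith
  qed
  define w where "w s t = c t + s *\<^sub>R (P t - c t)" for s t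
  have w_close: "norm (w s t - c t) < 1" if "s \<in> {0..1}" "t \<in> {0..1}" for s t
  proof -
    have "norm (w s t - c t) = s * norm (P t - c t)" using that by (simp add: w_def)
    also have "\<dots> \<le> 1 * norm (P t - c t)" using that by (intro mult_right_mono) auto
    finally show ?thesis using P_close [OF that(2)] by linarith
  qed
  have w_nz: "w s t \<noteq> 0" if "s \<in> {0..1}" "t \<in> {0..1}" for s t
    using w_close [OF that] c_norm [OF that(2)] by auto
  \<comment> \<open>This keeps the two arguments of
    \<open>reflection_to (- c t) (sgn (w s t))\<close> distinct.\<close>
  have w_opp: "sgn (w s t) \<noteq> - c t" if "s \<in> {0..1}" "t \<in> {0..1}" for s t
  proof
    assume "sgn (w s t) = - c t"
    then have "w s t = norm (w s t) *\<^sub>R (- c t)"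
      using w_nz [OF that] by (metis sgn_div_norm scaleR_scaleR right_inverse norm_eq_zero scaleR_one)
    then have "w s t - c t = - ((norm (w s t) + 1) *\<^sub>R c t)"
      by (simp add: scaleR_left_distrib)
    then have "norm (w s t - c t) = norm ((norm (w s t) + 1) *\<^sub>R c t)"
      by (metis norm_minus_cancel)
    also have "\<dots> = norm (w s t) + 1"
      using c_norm [OF that(2)] by simp
    finally show False using w_close [OF that] norm_ge_zero [of "w s t"] by linarith
  qed
  have w_opp': "- c t \<noteq> sgn (w s t)" if "s \<in> {0..1}" "t \<in> {0..1}" for s t
    using w_opp [OF that] by metis
  have w_S: "sgn (w s t) $ j = 0" if "t \<in> {0..1}" "j \<in> S" for s t j
    using c_S [OF that] that(2) by (simp add: w_def sgn_div_norm P_def L_def)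
  \<comment> \<open>For unit vectors \<open>x\<close> and \<open>y \<noteq> - x\<close>, reflecting \<open>x\<close> to \<open>- x\<close> and then to \<open>y\<close> is continuous
    in both and the identity for \<open>y = x\<close>.\<close>
  define H where "H s t = reflection_to (- c t) (sgn (w s t)) ** reflection_to (c t) (- c t) ** u t" for s t
  have cneg: "c t \<noteq> - c t" if "t \<in> {0..1}" for t
    using c_norm [OF that] by (auto simp: eq_neg_iff_add_eq_0 simp flip: scaleR_2)
  \<comment> \<open>Serves both for the start of the homotopy and for its fixed endpoints, where the
    approximation agrees with \<open>c\<close>.\<close>
  have H_same: "H s t = u t" if "t \<in> {0..1}" "w s t = c t" for s t
    using reflection_to_neg_cancel [OF c_norm [OF that(1)]] c_norm [OF that(1)] that(2)
    by (simp add: H_def sgn_div_norm)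
  have H_unit: "H s t \<in> unitary_group" if "s \<in> {0..1}" "t \<in> {0..1}" for s t
    unfolding H_def
    using that w_opp [OF that] w_nz [OF that] c_norm [OF that(2)] cneg [OF that(2)]
    by (intro unitary_mult reflection_to_unitary upathD(2) [OF u]) (auto simp: norm_sgn)
  have hom: "homotopic_paths unitary_group u (H 1)"
  proof (rule homotopic_pathsI [where H = H])
    have cf: "continuous_on ({0..1} \<times> {0..1}) (\<lambda>x::real \<times> real. c (snd x))"
      by (rule continuous_on_compose2 [OF c_cont]) (auto intro: continuous_on_snd)
    have uf: "continuous_on ({0..1} \<times> {0..1}) (\<lambda>x::real \<times> real. u (snd x))"
      by (rule continuous_on_compose2 [OF upathD(1) [OF u]]) (auto intro: continuous_on_snd)
    have Pf: "continuous_on ({0..1} \<times> {0..1}) (\<lambda>x::real \<times> real. P (snd x))"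
      by (rule continuous_on_compose2 [OF differentiable_imp_continuous_on [OF P_diff]])
         (auto intro: continuous_on_snd)
    have wf: "continuous_on ({0..1} \<times> {0..1}) (\<lambda>x::real \<times> real. w (fst x) (snd x))"
      unfolding w_def by (intro continuous_intros cf Pf)
    have sf: "continuous_on ({0..1} \<times> {0..1}) (\<lambda>x::real \<times> real. sgn (w (fst x) (snd x)))"
      by (intro continuous_on_sgn wf) (use w_nz in auto)
    show "continuous_on ({0..1} \<times> {0..1}) (\<lambda>x::real \<times> real. H (fst x) (snd x))"
      unfolding H_def
      by (intro continuous_on_matrix_mult continuous_on_refl_to uf cf sf continuous_on_minus)
         (use c_norm cneg w_nz w_opp' in \<open>auto simp: norm_sgn\<close>)
    have "P 0 = c 0" "P 1 = c 1" using p(2,3) Lc by (auto simp: P_def)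
    then show "H s 0 = u 0" "H s 1 = u 1" for s
      by (auto intro!: H_same simp: w_def)
    show "H 0 t = u t" if "t \<in> {0..1}" for t
      using that by (intro H_same) (auto simp: w_def)
  qed (use H_unit in auto)
  have P_nz: "P t \<noteq> 0" if "t \<in> {0..1}" for t
    using w_nz [of 1 t] that by (simp add: w_def)
  obtain q where q: "norm q = 1" "\<And>j. j \<noteq> i \<Longrightarrow> j \<noteq> k \<Longrightarrow> q $ j = 0"
    "\<And>t. t \<in> {0..1} \<Longrightarrow> sgn (P t) \<noteq> q"
    using differentiable_path_avoids [OF P_diff P_nz ik(3)] by blast
  have H_col: "H 1 t *v axis i 1 = sgn (P t)" if t: "t \<in> {0..1}" for t
  proof -
    have "H 1 t *v axis i 1 = reflection_to (- c t) (sgn (w 1 t)) *v (reflection_to (c t) (- c t) *v c t)"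
      by (simp add: H_def c_def matrix_vector_mul_assoc matrix_mul_assoc)
    also have "\<dots> = sgn (w 1 t)"
      using t w_opp' [of 1 t] w_nz [of 1 t] c_norm [OF t] cneg [OF t]
      by (simp add: reflection_to_vec norm_sgn)
    finally show ?thesis by (simp add: w_def)
  qed
  show thesis
  proof (rule that [OF hom _ q(1)])
    show "fixes_axes S (H 1 t)" if "t \<in> {0..1}" for t
      unfolding H_def using that c_S w_S
      by (intro fixes_axes_mult fixes_axes_refl_to fix_u) auto
    show "q $ j = 0" if "j \<in> S" for j using q(2) [of j] ik that by blast
    show "H 1 t *v axis i 1 \<noteq> q" if "t \<in> {0..1}" for t using H_col q(3) that by simp
  qed
qed

section \<open>Splitting off a coordinate\<close>

text \<open>Both edges are deformed to the diagonal; the two sides on which \<open>F\<close> is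
  constantly \<open>e\<close> keep the starting point fixed.\<close>

lemma homotopic_square_edges:
  fixes F :: "real \<Rightarrow> real \<Rightarrow> 'a::topological_space"
  assumes cont: "continuous_on ({0..1} \<times> {0..1}) (\<lambda>x. F (fst x) (snd x))"
    and S: "\<And>a b. a \<in> {0..1} \<Longrightarrow> b \<in> {0..1} \<Longrightarrow> F a b \<in> S"
    and left: "\<And>b. b \<in> {0..1} \<Longrightarrow> F 0 b = e" and bot: "\<And>a. a \<in> {0..1} \<Longrightarrow> F a 0 = e"
  shows "homotopic_paths S (\<lambda>t. F t 1) (\<lambda>t. F 1 t)"
proof -
  have in01: "(1 - s) * a + s \<in> {0..1}" if "s \<in> {0..1}" "a \<in> {0..1}" for s a :: real
    using that convex_bound_le [of a 1 1 "1 - s" s] by auto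
  have in01': "1 - s + s * a \<in> {0..1}" if "s \<in> {0..1}" "a \<in> {0..1}" for s a :: real
    using in01 [of "1 - s" a] that by (simp add: algebra_simps)
  have "homotopic_paths S (\<lambda>t. F t 1) (\<lambda>t. F t t)"
  proof (rule homotopic_pathsI [where H = "\<lambda>s t. F t (1 - s + s * t)"])
    show "continuous_on ({0..1} \<times> {0..1}) (\<lambda>x::real \<times> real. F (snd x) (1 - fst x + fst x * snd x))"
      by (rule continuous_on_compose2 [OF cont, of _ "\<lambda>x. (snd x, 1 - fst x + fst x * snd x)", simplified])
         (use in01' in \<open>auto intro!: continuous_intros\<close>)
  qed (use S in01' left in auto)
  also have "homotopic_paths S (\<lambda>t. F t t) (\<lambda>t. F 1 t)"
  proof (rule homotopic_pathsI [where H = "\<lambda>s t. F ((1 - s) * t + s) t"])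
    show "continuous_on ({0..1} \<times> {0..1}) (\<lambda>x::real \<times> real. F ((1 - fst x) * snd x + fst x) (snd x))"
      by (rule continuous_on_compose2 [OF cont, of _ "\<lambda>x. ((1 - fst x) * snd x + fst x, snd x)", simplified])
         (use in01 in \<open>auto intro!: continuous_intros\<close>)
  qed (use S in01 bot in auto)
  finally show ?thesis .
qed

text \<open>Orthogonality to the fixed axes leaves a single free entry, on the diagonal, and
  unitarity puts it on the unit circle.\<close>

lemma fixes_axes_all_but_one:
  fixes U :: "complex^'n^'n"
  assumes U: "U \<in> unitary_group" and "fixes_axes S U" "- S = {k}"
  shows "U = reflection (axis k 1) (U $ k $ k)" "cmod (U $ k $ k) = 1"
proof -
  have col: "U *v axis b 1 = (\<chi> a. U $ a $ b)" for b
    by (simp add: vec_eq_iff matrix_vector_mult_def axis_def if_distrib [of "\<lambda>c. _ * c"] cong: if_cong)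
  have kS: "k \<notin> S" "\<And>j. j \<noteq> k \<Longrightarrow> j \<in> S" using assms(3) by auto
  have Uk: "U $ a $ k = 0" if "a \<noteq> k" for a
    using fixes_axes_column [OF U assms(2) kS(2) [OF that] kS(1)] by (simp add: col)
  have "U $ a $ b = reflection (axis k 1) (U $ k $ k) $ a $ b" for a b
  proof (cases "b = k")
    case True
    then show ?thesis using Uk by (auto simp: reflection_def axis_def)
  next
    case False
    then have "U *v axis b 1 = axis b 1" using assms(2) kS(2) by (simp add: fixes_axes_def)
    then have "U $ a $ b = axis b 1 $ a" unfolding col vec_eq_iff by simp
    then show ?thesis using False by (auto simp: reflection_def axis_def)
  qed
  then show "U = reflection (axis k 1) (U $ k $ k)" unfolding vec_eq_iff by blast
  have "U *v axis k 1 = (U $ k $ k) *s axis k 1"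
    unfolding col using Uk by (auto simp: vec_eq_iff axis_def)
  then have "cin (U *v axis k 1) (U *v axis k 1) = U $ k $ k * cnj (U $ k $ k)"
    by (simp add: cin_smult_left cin_smult_right)
  then have "of_real ((cmod (U $ k $ k))\<^sup>2) = cin (axis k 1) (axis k (1::complex) :: complex^'n)"
    by (simp only: unitary_cin [OF U] complex_norm_square)
  also have "\<dots> = of_real 1" by simp
  finally have "(cmod (U $ k $ k))\<^sup>2 = 1" by (simp only: of_real_eq_iff)
  then show "cmod (U $ k $ k) = 1"
    using norm_ge_zero [of "U $ k $ k"] by (simp add: power2_eq_1_iff del: norm_ge_zero)
qed

text \<open>The base of the induction. The path is described by one continuous angle, and linear
  interpolation of angles deforms it to a turn at constant speed with the same winding.\<close>

lemma positive_path_axis: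
  assumes u: "upath u" and fix_u: "\<And>t. t \<in> {0..1} \<Longrightarrow> fixes_axes S (u t)" and S: "- S = {k}"
    and "winding u m" "0 \<le> m"
  shows "positive_path u"
proof -
  define z where "z t = u t $ k $ k" for t
  have z: "u t = reflection (axis k 1) (z t)" "cmod (z t) = 1" if "t \<in> {0..1}" for t
    unfolding z_def by (rule fixes_axes_all_but_one [OF upathD(2) [OF u that] fix_u [OF that] S])+
  have "continuous_on {0..1} z"
    unfolding z_def using upathD(1) [OF u] by (intro continuous_intros)
  then obtain \<phi> where \<phi>: "continuous_on {0..1} \<phi>" "\<And>t. t \<in> {0..1} \<Longrightarrow> z t = cis (\<phi> t)"
    using continuous_cis_lift [of "{0..1}" z] z(2) by auto
  have "z 0 = 1" using upathD(3) [OF u] by (simp add: z_def mat_def)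
  then have \<phi>0: "cis (\<phi> 0) = 1" using \<phi>(2) [of 0] by simp
  \<comment> \<open>Starting the lift at 0 makes it comparable with the linear angle
    \<open>t * \<psi> 1\<close>; the values of \<open>cis\<close> are unchanged because
    \<open>cis (\<phi> 0) = 1\<close>.\<close>
  define \<psi> where "\<psi> t = \<phi> t - \<phi> 0" for t
  have \<psi>: "continuous_on {0..1} \<psi>" "\<psi> 0 = 0" "\<And>t. t \<in> {0..1} \<Longrightarrow> z t = cis (\<psi> t)"
    using \<phi> \<phi>0 by (auto simp: \<psi>_def cis_divide [symmetric] intro: continuous_intros)
  have \<psi>f: "continuous_on ({0..1} \<times> {0..1}) (\<lambda>x::real \<times> real. \<psi> (snd x))"
    by (rule continuous_on_compose2 [OF \<psi>(1)]) (auto intro: continuous_on_snd)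
  have hom: "homotopic_paths unitary_group u (\<lambda>t. reflection (axis k 1) (cis (t * \<psi> 1)))"
  proof (rule homotopic_pathsI
      [where H = "\<lambda>s t. reflection (axis k 1) (cis ((1 - s) * \<psi> t + s * (t * \<psi> 1)))"])
    show "continuous_on ({0..1} \<times> {0..1})
       (\<lambda>x::real \<times> real. reflection (axis k 1) (cis ((1 - fst x) * \<psi> (snd x) + fst x * (snd x * \<psi> 1))))"
      by (intro continuous_intros \<psi>f)
  qed (use z \<psi> in \<open>auto intro: reflection_unitary simp: algebra_simps\<close>)
  have "m = \<psi> 1"
    by (rule winding_homotopic [OF hom assms(4)]) (simp add: winding_refl)
  then show ?thesis
    using positive_path_homotopic [OF hom positive_refl] assms(5) by simp
qed

text \<open>The induction step: fixing one more axis costs two turns by at most 2 pi each. The index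
  \<open>k\<close> supplies another free axis to carry the negative full turn.\<close>

lemma split_off_axis:
  fixes u :: "real \<Rightarrow> complex^'n^'n"
  assumes u: "upath u" and fix_u: "\<And>t. t \<in> {0..1} \<Longrightarrow> fixes_axes S (u t)"
    and ik: "i \<notin> S" "k \<notin> S" "i \<noteq> k"
  obtains x y \<alpha> \<beta> u' where "norm x = 1" "norm y = 1" "\<alpha> \<in> {0..2*pi}" "\<beta> \<in> {0..2*pi}"
    "upath u'" "\<And>t. t \<in> {0..1} \<Longrightarrow> fixes_axes (insert i S) (u' t)"
    "homotopic_paths unitary_group u (\<lambda>t. reflection x (cis (t * \<alpha>)) ** reflection y (cis (t * \<beta>)) ** u' t)"
proof -
  obtain v q where v: "homotopic_paths unitary_group u v" "\<And>t. t \<in> {0..1} \<Longrightarrow> fixes_axes S (v t)"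
    and q: "norm q = 1" "\<And>j. j \<in> S \<Longrightarrow> q $ j = 0"
    and vq: "\<And>t. t \<in> {0..1} \<Longrightarrow> v t *v axis i 1 \<noteq> q"
    using perturb_column [OF assms] by blast
  have uv: "upath v" using upath_homotopic [OF u v(1)] .
  define c where "c t = v t *v axis i 1" for t
  have c_cont: "continuous_on {0..1} c"
    unfolding c_def using upathD(1) [OF uv] by (intro continuous_intros)
  have c_norm: "norm (c t) = 1" if "t \<in> {0..1}" for t
    using upathD(2) [OF uv that] by (simp add: c_def unitary_norm)
  have c_S: "c t $ j = 0" if "t \<in> {0..1}" "j \<in> S" for t j
    using fixes_axes_column [OF upathD(2) [OF uv that(1)] v(2) [OF that(1)] that(2) ik(1)]
    by (simp add: c_def)
  have c_q: "q \<noteq> c t" if "t \<in> {0..1}" for t using vq [OF that] by (auto simp: c_def)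
  have c_0: "c 0 = axis i 1" using upathD(3) [OF uv] by (simp add: c_def)
  define W where "W t = reflection_to q (c t)" for t
  have W_unit: "W t \<in> unitary_group" if "t \<in> {0..1}" for t
    unfolding W_def using q c_norm c_q that by (intro reflection_to_unitary) auto
  have W_q: "W t *v q = c t" if "t \<in> {0..1}" for t
    unfolding W_def using q c_norm c_q that by (intro reflection_to_vec) auto
  have W_fix: "fixes_axes S (W t)" if "t \<in> {0..1}" for t
    unfolding W_def using q c_S that by (intro fixes_axes_refl_to) auto
  have W_cont: "continuous_on {0..1} W"
    unfolding W_def using q c_norm c_q by (intro continuous_on_refl_to c_cont continuous_intros) auto

  define d where "d t = 1 - cin (c t) q" for t
  have d_pos: "0 < Re (d t)" if "t \<in> {0..1}" for t
    unfolding d_def using q c_norm c_q that by (intro reflection_to_denom) auto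
  \<comment> \<open>The eigenvalue of \<open>W t\<close> is \<open>- cnj (d t) / d t\<close>, with
    argument pi minus twice that of \<open>d t\<close>. Since \<open>d t\<close> lies in the right
    half plane, this choice is continuous and between 0 and 2 pi.\<close>
  define \<theta> where "\<theta> t = pi - 2 * Im (Ln (d t))" for t
  have \<theta>_bds: "\<theta> t \<in> {0..2*pi}" if "t \<in> {0..1}" for t
    using Re_Ln_pos_lt_imp [OF d_pos [OF that]] by (auto simp: \<theta>_def abs_if split: if_splits)
  have d_cont: "continuous_on {0..1} d"
    unfolding d_def by (intro continuous_intros c_cont)
  have "continuous_on {0..1} (\<lambda>t. Ln (d t))"
    by (intro continuous_on_Ln' d_cont) (use d_pos in \<open>fastforce simp: complex_nonpos_Reals_iff\<close>)
  then have \<theta>_cont: "continuous_on {0..1} \<theta>"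
    unfolding \<theta>_def
    by (intro continuous_on_diff continuous_on_mult continuous_on_const continuous_on_Im)
  have \<theta>_cis: "cis (\<theta> t) = - cnj (d t) / d t" if "t \<in> {0..1}" for t
  proof -
    define \<alpha> where "\<alpha> = Im (Ln (d t))"
    have nz: "d t \<noteq> 0" using d_pos [OF that] by auto
    then have "d t = of_real (cmod (d t)) * cis \<alpha>"
      using exp_Ln [OF nz] by (simp add: exp_eq_polar \<alpha>_def)
    then have "- cnj (d t) / d t = - (cis (- \<alpha>) / cis \<alpha>)"
      using nz by (metis cis_cnj complex_cnj_complex_of_real complex_cnj_mult minus_divide_left
          mult_divide_mult_cancel_left norm_eq_zero of_real_eq_0_iff)
    also have "\<dots> = cis pi * cis (- \<alpha> - \<alpha>)" by (simp add: cis_divide)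
    also have "\<dots> = cis (\<theta> t)" unfolding cis_mult by (simp add: \<theta>_def \<alpha>_def)
    finally show ?thesis ..
  qed
  define \<nu> where "\<nu> t = sgn (q - c t)" for t
  have \<nu>_norm: "norm (\<nu> t) = 1" if "t \<in> {0..1}" for t
    using c_q [OF that] by (simp add: \<nu>_def norm_sgn)
  have \<nu>_cont: "continuous_on {0..1} \<nu>"
    unfolding \<nu>_def using c_q by (intro continuous_on_sgn continuous_intros c_cont) auto
  \<comment> \<open>For fixed \<open>t\<close> in the interval this runs from the identity at
    \<open>s = 0\<close> to \<open>W t\<close> at \<open>s = 1\<close>.\<close>
  define T where "T t s = reflection (\<nu> t) (cis (s * \<theta> t))" for t s
  have T1: "T t 1 = W t" if "t \<in> {0..1}" for t
    using \<theta>_cis [OF that] by (simp add: T_def W_def reflection_to_def \<nu>_def d_def)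
  have T_unit: "T t s \<in> unitary_group" if "t \<in> {0..1}" for t s
    unfolding T_def using \<nu>_norm [OF that] by (intro reflection_unitary) auto

  \<comment> \<open>Axis \<open>i\<close> is sent by \<open>v t\<close> to \<open>c t\<close>, then
    to \<open>q\<close>, then to \<open>c 0\<close>, which is axis \<open>i\<close> again.\<close>
  define u1 where "u1 t = W 0 ** cadj (W t) ** v t" for t
  have u1: "upath u1"
  proof (rule upathI)
    show "continuous_on {0..1} u1"
      unfolding u1_def using upathD(1) [OF uv] by (intro continuous_intros W_cont)
    show "u1 t \<in> unitary_group" if "t \<in> {0..1}" for t
      unfolding u1_def using W_unit [of 0] W_unit [OF that] upathD(2) [OF uv that]
      by (intro unitary_mult unitary_cadj) auto
    show "u1 0 = mat 1"
      using W_unit [of 0] upathD(3) [OF uv] by (simp add: u1_def unitary_right)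
  qed
  have u1_fix: "fixes_axes (insert i S) (u1 t)" if t: "t \<in> {0..1}" for t
  proof -
    have "fixes_axes S (u1 t)"
      unfolding u1_def
      using W_fix [of 0] W_fix [OF t] v(2) [OF t] W_unit [OF t]
      by (intro fixes_axes_mult fixes_axes_cadj) auto
    moreover have "u1 t *v axis i 1 = W 0 *v (cadj (W t) *v c t)"
      by (simp add: u1_def c_def matrix_vector_mul_assoc matrix_mul_assoc)
    then have "u1 t *v axis i 1 = axis i 1"
      using unitary_cadj_vec [OF W_unit [OF t] W_q [OF t]] W_q [of 0] c_0 by simp
    ultimately show ?thesis by (simp add: fixes_axes_def)
  qed
  have v_eq: "(T t 1 ** cadj (T 0 1)) ** u1 t = v t" if t: "t \<in> {0..1}" for t
  proof -
    have "(T t 1 ** cadj (T 0 1)) ** u1 t = W t ** (cadj (W 0) ** (W 0 ** (cadj (W t) ** v t)))"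
      using T1 [OF t] T1 [of 0] by (simp add: u1_def matrix_mul_assoc [symmetric])
    then show ?thesis using W_unit [of 0] W_unit [OF t] by simp
  qed

  define full where "full x = (\<lambda>s. reflection (x :: complex^'n) (cis (s * (2 * pi * of_int (- 1)))))" for x
  \<comment> \<open>The inverse of the turn by \<open>\<theta> 0\<close> has the negative angle
    \<open>- \<theta> 0\<close>; adding 2 pi makes it nonnegative, at the price of one negative full
    turn.\<close>
  define \<beta> where "\<beta> = 2 * pi - \<theta> 0"
  have split: "cadj (T 0 s) = reflection (\<nu> 0) (cis (s * \<beta>)) ** full (\<nu> 0) s" for s
    using \<nu>_norm [of 0]
    by (simp add: T_def full_def cadj_refl reflection_mult cis_cnj cis_mult \<beta>_def algebra_simps)
  \<comment> \<open>Path time and group time span a square that is the identity on two sides; the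
    other two edges are the path in \<open>W\<close> and a product of one-parameter groups.\<close>
  have "homotopic_paths unitary_group (\<lambda>t. T t 1 ** cadj (T 0 1)) (\<lambda>t. T 1 t ** cadj (T 0 t))"
  proof (rule homotopic_square_edges [where F = "\<lambda>a b. T a b ** cadj (T 0 b)" and e = "mat 1"])
    have \<theta>f: "continuous_on ({0..1} \<times> {0..1}) (\<lambda>x::real \<times> real. \<theta> (fst x))"
      by (rule continuous_on_compose2 [OF \<theta>_cont]) (auto intro: continuous_on_fst)
    have \<nu>f: "continuous_on ({0..1} \<times> {0..1}) (\<lambda>x::real \<times> real. \<nu> (fst x))"
      by (rule continuous_on_compose2 [OF \<nu>_cont]) (auto intro: continuous_on_fst)
    show "continuous_on ({0..1} \<times> {0..1}) (\<lambda>x::real \<times> real. T (fst x) (snd x) ** cadj (T 0 (snd x)))"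
      unfolding T_def by (intro continuous_intros \<theta>f \<nu>f)
    show "T 0 b ** cadj (T 0 b) = mat 1" if "b \<in> {0..1}" for b
      using T_unit [of 0 b] by (simp add: unitary_right)
    show "T a b ** cadj (T 0 b) \<in> unitary_group" if "a \<in> {0..1}" for a b
      using T_unit [of 0] T_unit [OF that] by (intro unitary_mult unitary_cadj) auto
  qed (simp add: T_def)
  from homotopic_mult [OF this upath_homotopic_refl [OF u1]]
  have "homotopic_paths unitary_group (\<lambda>t. (T t 1 ** cadj (T 0 1)) ** u1 t)
     (\<lambda>t. T 1 t ** cadj (T 0 t) ** u1 t)" .
  moreover have "homotopic_paths unitary_group v (\<lambda>t. (T t 1 ** cadj (T 0 1)) ** u1 t)"
    by (rule homotopic_paths_eq) (use uv v_eq in \<open>auto simp: upath_def\<close>)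
  ultimately have "homotopic_paths unitary_group u (\<lambda>t. T 1 t ** cadj (T 0 t) ** u1 t)"
    using v(1) homotopic_paths_trans by blast
  also have "(\<lambda>t. T 1 t ** cadj (T 0 t) ** u1 t) =
     (\<lambda>t. (T 1 t ** reflection (\<nu> 0) (cis (t * \<beta>))) ** (full (\<nu> 0) t ** u1 t))"
    unfolding split by (simp add: matrix_mul_assoc)
  also have "homotopic_paths unitary_group \<dots>
     (\<lambda>t. (T 1 t ** reflection (\<nu> 0) (cis (t * \<beta>))) ** (full (axis k 1) t ** u1 t))"
  proof (intro homotopic_mult)
    \<comment> \<open>Axis \<open>k\<close> is orthogonal to the axes of \<open>insert i S\<close>,
      so a full turn about it fixes them and can be absorbed into the remaining path.\<close>
    show "homotopic_paths unitary_group (full (\<nu> 0)) (full (axis k 1))"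
      unfolding full_def by (rule full_turn_homotopic) (use \<nu>_norm [of 0] in auto)
    show "homotopic_paths unitary_group (T 1) (T 1)"
      unfolding T_def using \<nu>_norm [of 1] by (intro upath_homotopic_refl upath_refl) auto
    show "homotopic_paths unitary_group (\<lambda>t. reflection (\<nu> 0) (cis (t * \<beta>))) (\<lambda>t. reflection (\<nu> 0) (cis (t * \<beta>)))"
      using \<nu>_norm [of 0] by (intro upath_homotopic_refl upath_refl) auto
  qed (rule upath_homotopic_refl [OF u1])
  finally have hom: "homotopic_paths unitary_group u (\<lambda>t. reflection (\<nu> 1) (cis (t * \<theta> 1)) **
      reflection (\<nu> 0) (cis (t * \<beta>)) ** (full (axis k 1) t ** u1 t))"
    by (simp add: T_def)
  show thesis
  proof (rule that [OF _ _ _ _ _ _ hom])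
    show "norm (\<nu> 1) = 1" "norm (\<nu> 0) = 1" "\<theta> 1 \<in> {0..2*pi}" "\<beta> \<in> {0..2*pi}"
      using \<nu>_norm \<theta>_bds [of 0] \<theta>_bds [of 1] by (auto simp: \<beta>_def)
    show "upath (\<lambda>t. full (axis k 1) t ** u1 t)"
      unfolding full_def by (intro upath_mult upath_refl u1) simp
    show "fixes_axes (insert i S) (full (axis k 1) t ** u1 t)" if "t \<in> {0..1}" for t
      unfolding full_def
      by (intro fixes_axes_mult fixes_axes_refl u1_fix that) (use ik in \<open>auto simp: axis_def\<close>)
  qed
qed

text \<open>Induction on the number of free coordinates. The constant depends on \<open>S\<close>
  but not on the path.\<close>

lemma large_winding_positive_fixing:
  fixes S :: "'n::finite set"
  assumes "S \<noteq> UNIV"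
  shows "\<exists>C. \<forall>(u :: real \<Rightarrow> complex^'n^'n) m. upath u \<longrightarrow> (\<forall>t\<in>{0..1}. fixes_axes S (u t)) \<longrightarrow>
    winding u m \<longrightarrow> C \<le> m \<longrightarrow> positive_path u"
  using assms
proof (induction "card (- S)" arbitrary: S rule: less_induct)
  case less
  then obtain i where i: "i \<notin> S" by auto
  show ?case
  proof (cases "- S = {i}")
    case True
    then show ?thesis using positive_path_axis by blast
  next
    case False
    then obtain k where k: "k \<notin> S" "i \<noteq> k" using i by auto
    have "card (- insert i S) < card (- S)"
      by (rule psubset_card_mono) (use i in auto)
    moreover have "insert i S \<noteq> UNIV" using k by auto
    ultimately obtain C where C: "\<And>(u :: real \<Rightarrow> complex^'n^'n) m. upath u \<Longrightarrow>
        (\<And>t. t \<in> {0..1} \<Longrightarrow> fixes_axes (insert i S) (u t)) \<Longrightarrow>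
        winding u m \<Longrightarrow> C \<le> m \<Longrightarrow> positive_path u"
      using less.hyps [of "insert i S"] by blast
    \<comment> \<open>The two turns split off use at most 4 pi of the winding, which leaves at least
      \<open>C\<close> for the rest.\<close>
    have "positive_path u" if u: "upath u" "\<forall>t\<in>{0..1}. fixes_axes S (u t)" "winding u m" "C + 4 * pi \<le> m"
      for u :: "real \<Rightarrow> complex^'n^'n" and m
    proof -
      obtain x y \<alpha> \<beta> u' where *: "norm x = 1" "norm y = 1" "\<alpha> \<in> {0..2*pi}" "\<beta> \<in> {0..2*pi}"
        "upath u'" "\<And>t. t \<in> {0..1} \<Longrightarrow> fixes_axes (insert i S) (u' t)"
        "homotopic_paths unitary_group u (\<lambda>t. reflection x (cis (t * \<alpha>)) ** reflection y (cis (t * \<beta>)) ** u' t)"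
        using split_off_axis [OF u(1) _ i k] u(2) by blast
      obtain m' where m': "winding u' m'" using winding_exists [OF *(5)] ..
      have "m = \<alpha> + \<beta> + m'"
        by (rule winding_homotopic [OF *(7) u(3)])
           (intro winding_mult winding_refl * m')
      then have "C \<le> m'" using *(3,4) u(4) by auto
      then have "positive_path u'" using C *(5,6) m' by blast
      then show ?thesis
        using *(3,4)
        by (intro positive_path_homotopic [OF *(7)] positive_path_mult positive_refl *(1,2)) auto
    qed
    then show ?thesis by blast
  qed
qed

lemma large_winding_positive:
  obtains C where "\<And>(u :: real \<Rightarrow> complex^'n^'n) m. upath u \<Longrightarrow> winding u m \<Longrightarrow> C \<le> m \<Longrightarrow> positive_path u"
  using large_winding_positive_fixing [of "{} :: 'n set"] by (auto simp: fixes_axes_def)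

section \<open>Relative growth\<close>

text \<open>Makes each diagonal entry a value of the quadratic form, so that the trace inherits its
  sign.\<close>

lemma qform_axis: "qform H (axis i 1) = H $ i $ i"
proof -
  have "(H *v axis i 1) $ i = H $ i $ i"
    by (simp add: matrix_vector_mult_def axis_def if_distrib [of "\<lambda>c. _ * c"] cong: if_cong)
  then show ?thesis by (simp add: qform_cin)
qed

lemma pos_semidef_trace: "pos_semidef H \<Longrightarrow> 0 \<le> Re (trace H)"
  unfolding pos_semidef_def trace_def by (auto simp flip: qform_axis intro: sum_nonneg)

lemma pos_def_trace: "pos_def H \<Longrightarrow> 0 < Re (trace H)"
  unfolding pos_def_def trace_def by (auto simp flip: qform_axis intro!: sum_pos)

section \<open>Comparing the order with \<open>mu\<close>\<close>

lemma ageq_iff: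
  assumes "amul f (ainv g) = cls u"
  shows "ageq f g \<longleftrightarrow> positive_path u"
  unfolding ageq_def positive_path_def assms by (auto simp: cls_def)

text \<open>By homotopy invariance the winding may be computed on the representative with
  semidefinite generator, as the integral of a nonnegative trace.\<close>

lemma positive_path_winding:
  assumes "positive_path u" "winding u m" shows "0 \<le> m"
proof -
  obtain w h where w: "homotopic_paths unitary_group u w" "hamiltonian_path w h"
     "\<forall>t\<in>{0..1}. pos_semidef (h t)"
    using assms(1) unfolding positive_path_def by blast
  have wU: "w t \<in> unitary_group" if "t \<in> {0..1}" for t
    using homotopic_paths_imp_subset [OF w(1)] that by (auto simp: path_image_def)
  have "m = integral {0..1} (\<lambda>t. Re (trace (h t)))"
    by (rule winding_homotopic [OF w(1) assms(2) winding_hamiltonian [OF wU w(2)]])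
  moreover have "0 \<le> integral {0..1} (\<lambda>t. Re (trace (h t)))"
    by (rule integral_nonneg)
       (use w(3) integrable_continuous_interval [OF hamiltonian_continuous_trace [OF wU w(2)]]
         in \<open>auto intro: pos_semidef_trace\<close>)
  ultimately show ?thesis by simp
qed

lemma ageq_imp_mu_le:
  assumes "f \<in> UC" "g \<in> UC" "ageq f g" shows "mu g \<le> mu f"
proof -
  have UC: "amul f (ainv g) \<in> UC" by (intro amul_UC ainv_UC assms)
  then obtain u where u: "upath u" "amul f (ainv g) = cls u" by (meson UC_E)
  obtain m where m: "winding u m" using winding_exists [OF u(1)] ..
  have "0 \<le> m"
    using ageq_iff [OF u(2)] assms(3) positive_path_winding m by blast
  also have "m = mu f - mu g"
    using mu_cls [OF u(1) m] u(2) amul_UC(2) [OF assms(1) ainv_UC(1) [OF assms(2)]] ainv_UC(2) [OF assms(2)]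
    by simp
  finally show ?thesis by simp
qed

text \<open>A converse of \<open>ageq_imp_mu_le\<close> up to an additive constant that serves all
  pairs of classes.\<close>

lemma large_mu_imp_ageq:
  obtains C where "\<And>f g :: (real \<Rightarrow> complex^'n^'n) set. f \<in> UC \<Longrightarrow> g \<in> UC \<Longrightarrow> C \<le> mu f - mu g \<Longrightarrow> ageq f g"
proof -
  obtain C where C: "\<And>(u :: real \<Rightarrow> complex^'n^'n) m. upath u \<Longrightarrow> winding u m \<Longrightarrow> C \<le> m \<Longrightarrow> positive_path u"
    using large_winding_positive by blast
  have "ageq f g" if fg: "f \<in> UC" "g \<in> UC" "C \<le> mu f - mu g" for f g :: "(real \<Rightarrow> complex^'n^'n) set"
  proof -
    have UC: "amul f (ainv g) \<in> UC" by (intro amul_UC ainv_UC fg)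
    then obtain u where u: "upath u" "amul f (ainv g) = cls u" by (meson UC_E)
    obtain m where m: "winding u m" using winding_exists [OF u(1)] ..
    have "m = mu f - mu g"
      using mu_cls [OF u(1) m] u(2) amul_UC(2) [OF fg(1) ainv_UC(1) [OF fg(2)]] ainv_UC(2) [OF fg(2)]
      by simp
    then have "positive_path u" using C [OF u(1) m] fg(3) by simp
    then show ?thesis using ageq_iff [OF u(2)] by simp
  qed
  then show thesis using that by blast
qed

lemma dominant_mu_pos:
  assumes "dominant f" shows "f \<in> UC" "0 < mu f"
proof -
  show UC: "f \<in> UC" using assms by (simp add: dominant_def)
  obtain u h where u: "u \<in> f" "hamiltonian_path u h" "\<forall>t\<in>{0..1}. pos_def (h t)"
    using assms by (auto simp: dominant_def)
  note uf = UC_member [OF UC u(1)]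
  let ?\<tau> = "\<lambda>t. Re (trace (h t))"
  note cont = hamiltonian_continuous_trace [OF upathD(2) [OF uf(1)] u(2)]
  \<comment> \<open>The minimum of the positive continuous trace over the compact interval bounds
    the integral strictly away from zero.\<close>
  obtain t0 where t0: "t0 \<in> {0..1}" "\<And>t. t \<in> {0..1} \<Longrightarrow> ?\<tau> t0 \<le> ?\<tau> t"
    using continuous_attains_inf [OF _ _ cont] by auto
  have "0 < ?\<tau> t0" using u(3) t0(1) by (intro pos_def_trace) auto
  also have "?\<tau> t0 = integral {0..1} (\<lambda>t::real. ?\<tau> t0)" by simp
  also have "\<dots> \<le> integral {0..1} ?\<tau>"
    by (rule integral_le) (use t0 integrable_continuous_interval [OF cont] in auto)
  also have "\<dots> = mu f"
    using mu_cls [OF uf(1) winding_hamiltonian [OF upathD(2) [OF uf(1)] u(2)]] uf(2) by simp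
  finally show "0 < mu f" .
qed

theorem mainTheorem4:
  fixes f g :: "(real \<Rightarrow> complex^'n^'n) set"
  assumes "dominant f" and "dominant g"
  shows "(\<lambda>n. gamma_n f g n / real n) \<longlonglongrightarrow> mu g / mu f"
proof -
  note f = dominant_mu_pos [OF assms(1)] and g = dominant_mu_pos [OF assms(2)]
  obtain C where C: "\<And>a b :: (real \<Rightarrow> complex^'n^'n) set. a \<in> UC \<Longrightarrow> b \<in> UC \<Longrightarrow> C \<le> mu a - mu b \<Longrightarrow> ageq a b"
    using large_mu_imp_ageq by blast
  \<comment> \<open>The constant \<open>C\<close> measured in units of \<open>mu f\<close>, plus one
    for rounding up to an integer exponent; it does not depend on \<open>n\<close>.\<close>
  define D where "D = C / mu f + 1"
  have bounds: "real n * (mu g / mu f) \<le> gamma_n f g n \<and> gamma_n f g n \<le> real n * (mu g / mu f) + D" for n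
  proof -
    let ?A = "{p::int. ageq (apow f p) (apow g (int n))}"
    have lower: "real n * (mu g / mu f) \<le> of_int p" if "p \<in> ?A" for p
    proof -
      have "real n * mu g \<le> of_int p * mu f"
        using ageq_imp_mu_le [OF apow_UC(1) [OF f(1), of p] apow_UC(1) [OF g(1), of "int n"]] that
        by (simp add: apow_UC f g)
      then show ?thesis using f(2) by (simp add: field_simps)
    qed
    \<comment> \<open>The least integer for which the gap
      \<open>of_int p * mu f - real n * mu g\<close> reaches \<open>C\<close>.\<close>
    define p where "p = \<lceil>(real n * mu g + C) / mu f\<rceil>"
    have "(real n * mu g + C) / mu f \<le> of_int p" by (simp add: p_def)
    then have "C \<le> of_int p * mu f - real n * mu g" using f(2) by (simp add: field_simps)
    then have p: "p \<in> ?A" using C [of "apow f p" "apow g (int n)"] by (simp add: apow_UC f g)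
    have "of_int p \<le> (real n * mu g + C) / mu f + 1" unfolding p_def by linarith
    also have "\<dots> = real n * (mu g / mu f) + D" by (simp add: D_def add_divide_distrib)
    finally have upper: "of_int p \<le> real n * (mu g / mu f) + D" .
    \<comment> \<open>The set contains \<open>p\<close> and is bounded below by
      \<open>lower\<close>, so the real \<open>Inf\<close> is a genuine greatest lower
      bound.\<close>
    have "gamma_n f g n \<le> of_int p"
      unfolding gamma_n_def by (rule cInf_lower) (use p lower in \<open>auto intro!: bdd_belowI2\<close>)
    moreover have "real n * (mu g / mu f) \<le> gamma_n f g n"
      unfolding gamma_n_def by (rule cInf_greatest) (use p lower in auto)
    ultimately show ?thesis using upper by linarith
  qed
  show ?thesis
  proof (rule tendsto_sandwich [where f = "\<lambda>n. mu g / mu f" and h = "\<lambda>n. mu g / mu f + D / real n"])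
    show "eventually (\<lambda>n. mu g / mu f \<le> gamma_n f g n / real n) sequentially"
      using eventually_gt_at_top [of 0]
      by eventually_elim (use bounds in \<open>simp add: pos_le_divide_eq mult.commute\<close>)
    show "eventually (\<lambda>n. gamma_n f g n / real n \<le> mu g / mu f + D / real n) sequentially"
      using eventually_gt_at_top [of 0]
    proof eventually_elim
      case (elim n)
      have "gamma_n f g n / real n \<le> (real n * (mu g / mu f) + D) / real n"
        using bounds [of n] by (intro divide_right_mono) auto
      also have "\<dots> = mu g / mu f + D / real n" using elim by (simp add: add_divide_distrib)
      finally show ?case .
    qed
    have "(\<lambda>n. mu g / mu f + D / real n) \<longlonglongrightarrow> mu g / mu f + 0"
      by (intro tendsto_intros lim_const_over_n)
    then show "(\<lambda>n. mu g / mu f + D / real n) \<longlonglongrightarrow> mu g / mu f" by simp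
  qed simp
qed

end
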